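(* Let $n$ be a positive integer and let $k,m,a$ be complex numbers with $a\neq0$ such that all the functions below are defined. Then $$\sum _{p=1}^n \frac{1}{2} \left(i 2^{-p}\right)^k e^{i 2^{-p} m \pi } \pi ^{1+k} \Big(2 i\, \Phi \left(-e^{i 2^{-p} m \pi },-k,1-\tfrac{i 2^p \log (a)}{\pi }\right)+\Phi \left(-i e^{i 2^{-p} m \pi },-k,1-\tfrac{i 2^p \log (a)}{\pi }\right)-\Phi \left(i e^{i 2^{-p} m \pi },-k,1-\tfrac{i 2^p \log (a)}{\pi }\right)\Big)$$ $$=-i \pi \left(e^{i m \pi } (i \pi )^k\, \Phi \left(-e^{i m \pi },-k,1-\tfrac{i \log (a)}{\pi }\right)-\left(i 2^{-n}\right)^k e^{i 2^{-n} m \pi } \pi ^k\, \Phi \left(-e^{i 2^{-n} m \pi },-k,1-\tfrac{i 2^n \log (a)}{\pi }\right)\right).$$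
   Context: $\Phi(z,s,v)$ is the Hurwitz–Lerch zeta function: $\Phi(z,s,v)=\sum_{j=0}^{\infty}\frac{z^j}{(j+v)^s}$ for $v\notin\{0,-1,-2,\dots\}$ and $|z|<1$ (or $|z|=1$, $\operatorname{Re}s>1$), and by analytic continuation (principal branch, cut along $z\in[1,\infty)$) for other values; $\Phi(1,s,v)$ is the Hurwitz zeta function $\zeta(s,v)$. Logarithms and powers are principal values. *)

theory Defs
  imports "HOL-Complex_Analysis.Complex_Analysis"
begin

text \<open>
  The holomorphic continuation of \<open>g\<close> from \<open>U\<close> to \<open>S\<close>. It is only used where \<open>S\<close> is open and
  connected and \<open>U\<close> is a nonempty open subset of \<open>S\<close>; by the identity theorem its values on \<open>S\<close>
  then do not depend on the choice. Its values off \<open>S\<close> are meaningless.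
\<close>

definition continuation ::
    "(complex \<Rightarrow> complex) \<Rightarrow> complex set \<Rightarrow> complex set \<Rightarrow> complex \<Rightarrow> complex" where
  "continuation g U S = (SOME f. f holomorphic_on S \<and> (\<forall>w\<in>U. f w = g w))"

definition lerch_series :: "complex \<Rightarrow> complex \<Rightarrow> complex \<Rightarrow> complex" where
  "lerch_series z s v = (\<Sum>j. z ^ j / (of_nat j + v) powr s)"

definition hurwitz_zeta :: "complex \<Rightarrow> complex \<Rightarrow> complex" where
  "hurwitz_zeta s v = continuation (\<lambda>t. lerch_series 1 t v) {t. Re t > 1} (- {1}) s"

definition lerch_cut :: "complex set" where
  "lerch_cut = complex_of_real ` {1..}"

text \<open>
  The continuation is in \<open>z\<close>, for fixed \<open>s\<close> and \<open>v\<close>. The point \<open>z = 1\<close> lies on the cut; there the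
  function is the Hurwitz zeta function, which is continued in \<open>s\<close> instead.
\<close>

definition lerch_phi :: "complex \<Rightarrow> complex \<Rightarrow> complex \<Rightarrow> complex" where
  "lerch_phi z s v =
     (if norm z < 1 \<or> norm z = 1 \<and> Re s > 1 then lerch_series z s v
      else if z = 1 then hurwitz_zeta s v
      else continuation (\<lambda>w. lerch_series w s v) (ball 0 1) (- lerch_cut) z)"

text \<open>
  No value is assigned on the cut beyond \<open>z = 1\<close>, nor at the pole \<open>s = 1\<close> of the Hurwitz zeta
  function.
\<close>

definition lerch_phi_defined :: "complex \<Rightarrow> complex \<Rightarrow> complex \<Rightarrow> bool" where
  "lerch_phi_defined z s v \<longleftrightarrow> v \<notin> \<int>\<^sub>\<le>\<^sub>0 \<and> (z \<notin> lerch_cut \<or> z = 1 \<and> s \<noteq> 1)"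

end

theory Submission
  imports Defs
begin

text \<open>
  Write \<open>E\<^sub>p = exp (\<i> m \<pi> / 2\<^sup>p)\<close> and \<open>v\<^sub>p = 1 - \<i> 2\<^sup>p Ln a / \<pi>\<close>, so that \<open>E\<^sub>p\<close> squares to \<open>E\<close> at \<open>p - 1\<close>
  and \<open>(1 + v\<^sub>p) / 2\<close> is \<open>v\<close> at \<open>p - 1\<close>. In the difference of the series of \<open>\<Phi>(w, s, v)\<close> and
  \<open>\<Phi>(- w, s, v)\<close> the even terms cancel, and the odd ones form a Lerch series again:
  \<open>\<Phi>(w, s, v) - \<Phi>(- w, s, v) = 2 powr (1 - s) * w * \<Phi>(w\<^sup>2, s, (1 + v) / 2)\<close>.
  With \<open>w = \<i> E\<^sub>p\<close> and \<open>s = - k\<close> this turns the last two values of \<open>\<Phi>\<close> in the \<open>p\<close>-th summand into the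
  first value of the summand before it, up to a factor that makes the sum telescope.

  The work lies in proving this duplication formula (\<open>lerch_phi_duplication\<close>) wherever \<open>\<Phi>\<close> is given
  by a continuation. That needs existence of the continuations, since otherwise \<open>continuation\<close>
  returns an arbitrary function; once they exist, the identity theorem carries the formula over.

  Existence in \<open>z\<close> (\<open>is_lerch_exists\<close>): for \<open>Re s > 0\<close> and \<open>Re v > 0\<close> the integral
  \<open>\<integral> t powr (s - 1) * exp (- v t) / (1 - z exp (- t))\<close> over \<open>t > 0\<close>, divided by \<open>Gamma s\<close>, is
  holomorphic off the cut. The operator \<open>z d/dz + v\<close> maps \<open>\<Phi>(z, s, v)\<close> to \<open>\<Phi>(z, s - 1, v)\<close>, which
  reaches all \<open>s\<close>, and splitting off the first term of the series reaches all \<open>v\<close>.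

  On the unit circle with \<open>Re s \<le> 1\<close> the formula at \<open>w = 1\<close> and \<open>w = - 1\<close> is of a different kind: it
  relates the Hurwitz zeta function, continued in \<open>s\<close>, to \<open>\<Phi>(- 1, s, v)\<close>, continued in \<open>z\<close>. There one
  needs the Hurwitz zeta function to exist on all of \<open>s \<noteq> 1\<close> and \<open>\<Phi>(- 1, s, v)\<close> to be entire in \<open>s\<close>
  (\<open>hurwitz_zeta_continues\<close>, \<open>lerch_cont_minus_1\<close>). Both follow from one mechanism. As
  \<open>d/dv \<Phi>(z, s, v) = - s \<Phi>(z, s + 1, v)\<close>, integrating over \<open>v\<close> to \<open>v + 1\<close> expresses the function at
  \<open>s\<close> by an integral of the function at \<open>s + 1\<close>, and such a relation extends a function that is
  holomorphic in \<open>s\<close> on a half-plane to the whole plane, one strip after the other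
  (\<open>holomorphic_family_extend\<close>).
\<close>

section \<open>Holomorphic dependence of an integral on a parameter\<close>

text \<open>
  Cauchy's estimate bounds the derivative of the integrand in the parameter by the same local
  majorant, up to the factor \<open>2 / r\<close>; hence so are the difference quotients, and dominated convergence
  gives the derivative of the integral.
\<close>

lemma holomorphic_on_lebesgue_integral:
  fixes f :: "complex \<Rightarrow> 'a \<Rightarrow> complex"
  assumes "open U"
    and hol: "\<And>t. t \<in> space M \<Longrightarrow> (\<lambda>z. f z t) holomorphic_on U"
    and meas: "\<And>z. z \<in> U \<Longrightarrow> f z \<in> borel_measurable M"
    and dom: "\<And>z. z \<in> U \<Longrightarrow> \<exists>r>0. \<exists>g. cball z r \<subseteq> U \<and> integrable M g \<and>
                (\<forall>w\<in>cball z r. \<forall>t\<in>space M. norm (f w t) \<le> g t)"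
  shows "(\<lambda>z. \<integral>t. f z t \<partial>M) holomorphic_on U"
proof -
  have "\<exists>D. ((\<lambda>z. \<integral>t. f z t \<partial>M) has_field_derivative D) (at z)" if z: "z \<in> U" for z
  proof -
    obtain r g where r: "r > 0" "cball z r \<subseteq> U" and g: "integrable M g"
      and bd: "\<And>w t. w \<in> cball z r \<Longrightarrow> t \<in> space M \<Longrightarrow> norm (f w t) \<le> g t"
      using dom[OF z] by blast
    have int: "integrable M (f w)" if "w \<in> cball z r" for w
      by (rule Bochner_Integration.integrable_bound[OF g])
         (use that meas r bd in \<open>force intro!: AE_I2 order_trans[OF bd]\<close>)+
    have lip: "norm (f w t - f z t) \<le> 2 * g t / r * norm (w - z)"
      if w: "w \<in> cball z (r/2)" and t: "t \<in> space M" for w t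
    proof (rule field_differentiable_bound[where S = "cball z (r/2)" and f' = "deriv (\<lambda>z. f z t)"])
      fix x assume x: "x \<in> cball z (r/2)"
      have sub: "cball x (r/2) \<subseteq> cball z r"
        using x by (auto simp: dist_norm) (smt (verit, ccfv_threshold) dist_norm dist_triangle field_sum_of_halves)
      have hx: "(\<lambda>z. f z t) holomorphic_on cball x (r/2)"
        using hol[OF t] sub r by (meson holomorphic_on_subset order_trans)
      have "(\<lambda>z. f z t) field_differentiable at x"
        using hol[OF t] x r \<open>open U\<close> sub
        by (meson centre_in_cball half_gt_zero_iff holomorphic_on_imp_differentiable_at less_imp_le subsetD)
      then show "((\<lambda>z. f z t) has_field_derivative deriv (\<lambda>z. f z t) x) (at x within cball z (r / 2))"
        by (simp add: field_differentiable_derivI has_field_derivative_at_within)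
      have "norm ((deriv ^^ 1) (\<lambda>z. f z t) x) \<le> fact 1 * g t / (r/2) ^ 1"
      proof (rule Cauchy_inequality)
        show "(\<lambda>z. f z t) holomorphic_on ball x (r/2)"
          using hx ball_subset_cball holomorphic_on_subset by blast
        show "continuous_on (cball x (r/2)) (\<lambda>z. f z t)"
          using hx by (rule holomorphic_on_imp_continuous_on)
        show "norm (f y t) \<le> g t" if "norm (x - y) = r/2" for y
          using that sub by (intro bd t) (auto simp: dist_norm)
      qed (use r in auto)
      then show "norm (deriv (\<lambda>z. f z t) x) \<le> 2 * g t / r" by (simp add: field_simps)
    qed (use w r in auto)
    define D where "D = (\<integral>t. deriv (\<lambda>z. f z t) z \<partial>M)"
    have "((\<lambda>z. \<integral>t. f z t \<partial>M) has_field_derivative D) (at z)"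
      unfolding has_field_derivative_iff tendsto_at_iff_sequentially
    proof (intro allI impI)
      fix X assume X: "\<forall>i. X i \<in> UNIV - {z}" "X \<longlonglongrightarrow> z"
      have "eventually (\<lambda>i. X i \<in> ball z (r/2)) sequentially"
        using X(2) r by (intro topological_tendstoD) auto
      \<comment> \<open>the sequence is cut off so that the majorant applies to all of its terms\<close>
      then obtain N where N: "\<And>i. i \<ge> N \<Longrightarrow> X i \<in> ball z (r/2)"
        by (auto simp: eventually_sequentially)
      define Y where "Y i = X (i + N)" for i
      have Y: "Y i \<in> cball z (r/2)" "Y i \<noteq> z" "Y i \<in> cball z r" for i
        using X(1) N[of "i+N"] r by (auto simp: Y_def)
      have Yl: "Y \<longlonglongrightarrow> z" unfolding Y_def using X(2) by (rule LIMSEQ_ignore_initial_segment)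
      let ?q = "\<lambda>i t. (f (Y i) t - f z t) / (Y i - z)"
      have qlim: "(\<lambda>i. ?q i t) \<longlonglongrightarrow> deriv (\<lambda>z. f z t) z" if t: "t \<in> space M" for t
      proof -
        have "((\<lambda>z. f z t) has_field_derivative deriv (\<lambda>z. f z t) z) (at z)"
          using hol[OF t] z \<open>open U\<close> by (simp add: holomorphic_derivI)
        then have "((\<lambda>y. (f y t - f z t) / (y - z)) \<circ> Y) \<longlonglongrightarrow> deriv (\<lambda>z. f z t) z"
          using Y Yl unfolding has_field_derivative_iff tendsto_at_iff_sequentially by blast
        then show ?thesis by (simp add: o_def)
      qed
      have "Y i \<in> U" for i using Y(3) r(2) by blast
      then have qm: "?q i \<in> borel_measurable M" for i
        using meas[OF z] meas by (intro borel_measurable_divide borel_measurable_diff) auto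
      have "(\<lambda>i. \<integral>t. ?q i t \<partial>M) \<longlonglongrightarrow> D"
        unfolding D_def
      proof (rule integral_dominated_convergence[where w = "\<lambda>t. 2 * g t / r"])
        show "(\<lambda>t. deriv (\<lambda>z. f z t) z) \<in> borel_measurable M"
          by (rule borel_measurable_LIMSEQ_metric[OF qm qlim])
        show "integrable M (\<lambda>t. 2 * g t / r)" using g by auto
        show "AE t in M. norm (?q i t) \<le> 2 * g t / r" for i
        proof (rule AE_I2)
          fix t assume "t \<in> space M"
          from lip[OF Y(1) this, of i] Y(2)[of i]
          show "norm (?q i t) \<le> 2 * g t / r" by (simp add: norm_divide pos_divide_le_eq)
        qed
      qed (use qm qlim in auto)
      moreover have "(\<integral>t. ?q i t \<partial>M) = ((\<integral>t. f (Y i) t \<partial>M) - (\<integral>t. f z t \<partial>M)) / (Y i - z)" for i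
        using int[of z] int[OF Y(3), of i] r Y(2)[of i] by (simp add: Bochner_Integration.integral_diff)
      ultimately have "(\<lambda>i. ((\<integral>t. f (Y i) t \<partial>M) - (\<integral>t. f z t \<partial>M)) / (Y i - z)) \<longlonglongrightarrow> D"
        by (simp only:)
      then show "((\<lambda>y. ((\<integral>t. f y t \<partial>M) - (\<integral>t. f z t \<partial>M)) / (y - z)) \<circ> X) \<longlonglongrightarrow> D"
        unfolding o_def Y_def by (rule LIMSEQ_offset)
    qed
    then show ?thesis ..
  qed
  then show ?thesis using \<open>open U\<close> by (simp add: holomorphic_on_open)
qed

section \<open>The Gamma integral with a complex rate\<close>

text \<open>
  The integrand \<open>t powr (s - 1) * exp (- w t)\<close> of the Gamma integral, extended by zero to all
  real \<open>t\<close>. The power is written as an exponential, which makes measurability and the substitution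
  \<open>t \<mapsto> x t\<close> immediate.
\<close>

definition mellin_kernel :: "complex \<Rightarrow> complex \<Rightarrow> real \<Rightarrow> complex" where
  "mellin_kernel s w t = (if t > 0 then exp ((s - 1) * of_real (ln t) - w * of_real t) else 0)"

lemma mellin_kernel_measurable [measurable]: "mellin_kernel s w \<in> borel_measurable borel"
proof -
  have [measurable]: "(exp :: complex \<Rightarrow> complex) \<in> borel_measurable borel"
    by (intro borel_measurable_continuous_onI continuous_intros)
  show ?thesis unfolding mellin_kernel_def by measurable
qed

lemma norm_mellin_kernel:
  "norm (mellin_kernel s w t) = Re (mellin_kernel (of_real (Re s)) (of_real (Re w)) t)"
  by (simp add: mellin_kernel_def Re_exp)

lemma mellin_kernel_1:
  assumes "Re s > 0"
  shows "has_bochner_integral lborel (mellin_kernel s 1) (Gamma s)"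
proof -
  let ?g = "\<lambda>t. complex_of_real t powr (s - 1) / of_real (exp t)"
  have eq: "mellin_kernel s 1 = (\<lambda>t. indicator {0<..} t *\<^sub>R ?g t)"
    by (auto simp: mellin_kernel_def indicator_def powr_def exp_diff fun_eq_iff Ln_of_real exp_of_real)
  have ab: "set_integrable lebesgue {0<..} ?g"
    by (rule absolutely_integrable_Gamma_integral'[OF assms])
  then have "integrable lborel (mellin_kernel s 1)"
    unfolding set_integrable_def eq[symmetric] by (subst (asm) integrable_completion) auto
  moreover have "integral\<^sup>L lborel (mellin_kernel s 1) = Gamma s"
  proof -
    have "integral\<^sup>L lebesgue (mellin_kernel s 1) = integral {0<..} ?g"
      using set_lebesgue_integral_eq_integral(2)[OF ab] by (simp add: set_lebesgue_integral_def eq)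
    also have "\<dots> = Gamma s" using Gamma_integral_complex'[OF assms] by (rule integral_unique)
    finally show ?thesis by (subst (asm) integral_completion) auto
  qed
  ultimately show ?thesis by (simp add: has_bochner_integral_iff)
qed

text \<open>
  For a real rate \<open>x\<close> the substitution \<open>t \<mapsto> x t\<close> reduces the integral to Euler's.
\<close>

lemma mellin_kernel_real:
  assumes "Re s > 0" "x > 0"
  shows "has_bochner_integral lborel (mellin_kernel s (of_real x)) (Gamma s * of_real x powr (- s))"
proof -
  let ?c = "exp (- (s - 1) * of_real (ln x))"
  have eq: "mellin_kernel s (of_real x) t = ?c * mellin_kernel s 1 (0 + x * t)" for t
    using assms(2)
    by (auto simp: mellin_kernel_def ln_mult zero_less_mult_iff algebra_simps simp flip: exp_add)
  have "has_bochner_integral lborel (\<lambda>t. mellin_kernel s 1 (0 + x * t)) (Gamma s /\<^sub>R \<bar>x\<bar>)"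
    using mellin_kernel_1[OF assms(1)] assms(2)
    by (subst lborel_has_bochner_integral_real_affine_iff[of x _ _ 0, symmetric]) auto
  then have "has_bochner_integral lborel (mellin_kernel s (of_real x)) (?c * (Gamma s /\<^sub>R \<bar>x\<bar>))"
    unfolding eq by (rule has_bochner_integral_mult_right)
  also have "?c * (Gamma s /\<^sub>R \<bar>x\<bar>) = Gamma s * of_real x powr (- s)"
    using assms(2)
    by (simp add: powr_def Ln_of_real scaleR_conv_of_real algebra_simps exp_diff exp_minus exp_add
                  exp_of_real divide_simps)
  finally show ?thesis .
qed

lemma mellin_kernel_integrable:
  assumes "Re s > 0" "Re w > 0"
  shows "integrable lborel (mellin_kernel s w)"
proof (rule Bochner_Integration.integrable_bound)
  show "integrable lborel (\<lambda>t. Re (mellin_kernel (of_real (Re s)) (of_real (Re w)) t))"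
    using mellin_kernel_real[of "of_real (Re s)" "Re w"] assms
    by (auto simp: has_bochner_integral_iff)
  show "AE t in lborel. norm (mellin_kernel s w t)
          \<le> norm (Re (mellin_kernel (of_real (Re s)) (of_real (Re w)) t))"
    by (intro AE_I2) (simp add: norm_mellin_kernel)
qed simp

text \<open>
  A substitution is not possible for a complex rate \<open>w\<close>, but both sides are holomorphic on
  \<open>Re w > 0\<close> and agree on the positive real axis.
\<close>

lemma mellin_kernel_integral:
  assumes s: "Re s > 0" and w: "Re w > 0"
  shows "integral\<^sup>L lborel (mellin_kernel s w) = Gamma s * w powr (- s)"
proof -
  let ?H = "{w::complex. Re w > 0}"
  have op: "open ?H" by (rule open_halfspace_Re_gt)
  have hol: "(\<lambda>w. \<integral>t. mellin_kernel s w t \<partial>lborel) holomorphic_on ?H"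
  proof (rule holomorphic_on_lebesgue_integral[OF op])
    show "(\<lambda>w. mellin_kernel s w t) holomorphic_on ?H" for t
      unfolding mellin_kernel_def by (cases "t > 0") (auto intro!: holomorphic_intros)
    fix z assume z: "z \<in> ?H"
    have c: "Re w \<ge> Re z / 2" if "w \<in> cball z (Re z / 2)" for w
      using that abs_Re_le_cmod[of "z - w"] by (auto simp: dist_norm)
    let ?g = "\<lambda>t. Re (mellin_kernel (of_real (Re s)) (of_real (Re z / 2)) t)"
    have "integrable lborel ?g"
      by (rule integrable_Re[OF mellin_kernel_integrable]) (use s z in auto)
    moreover have "norm (mellin_kernel s w t) \<le> ?g t" if "w \<in> cball z (Re z / 2)" for w t
      using c[OF that] by (auto simp: norm_mellin_kernel mellin_kernel_def Re_exp mult_right_mono)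
    moreover have "cball z (Re z / 2) \<subseteq> ?H" using c z by fastforce
    ultimately show "\<exists>r>0. \<exists>g. cball z r \<subseteq> ?H \<and> integrable lborel g \<and>
                (\<forall>w\<in>cball z r. \<forall>t\<in>space lborel. norm (mellin_kernel s w t) \<le> g t)"
      using z by (intro exI[of _ "Re z / 2"] conjI exI[of _ ?g]) auto
  qed auto
  let ?f = "\<lambda>w. (\<integral>t. mellin_kernel s w t \<partial>lborel) - Gamma s * w powr (- s)"
  have "?f w = 0"
  proof (rule analytic_continuation[of ?f ?H "complex_of_real ` {0<..}" 1])
    show "?f holomorphic_on ?H"
      by (intro holomorphic_intros hol) (auto simp: complex_nonpos_Reals_iff)
    show "connected ?H" by (intro convex_connected convex_halfspace_Re_gt)
    show "(1::complex) islimpt complex_of_real ` {0<..}"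
    proof -
      have "(\<lambda>n. complex_of_real (1 + 1 / real (Suc n))) \<longlonglongrightarrow> of_real (1 + 0)"
        by (intro tendsto_of_real tendsto_add tendsto_const LIMSEQ_Suc[OF lim_1_over_n])
      then show ?thesis unfolding islimpt_sequential
        by (intro exI[of _ "\<lambda>n. complex_of_real (1 + 1 / real (Suc n))"])
           (auto intro!: imageI add_pos_pos simp: add_eq_0_iff simp del: of_nat_Suc of_real_add)
    qed
    show "?f z = 0" if "z \<in> complex_of_real ` {0<..}" for z
      using that mellin_kernel_real[OF s] by (auto simp: has_bochner_integral_iff)
  qed (use w op in auto)
  then show ?thesis by simp
qed

section \<open>Continuation of the Lerch series in the variable z\<close>

lemma lerch_cut_eq: "lerch_cut = {z. Im z = 0 \<and> Re z \<ge> 1}"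
  by (auto simp: lerch_cut_def complex_eq_iff intro!: image_eqI[of _ _ "Re _"])

lemma open_compl_lerch_cut: "open (- lerch_cut)"
proof -
  have "closed ({z. Im z = 0} \<inter> {z. Re z \<ge> 1})"
    by (intro closed_Int closed_Collect_eq closed_halfspace_Re_ge continuous_intros)
  then show ?thesis unfolding lerch_cut_eq by (simp add: Collect_conj_eq open_closed)
qed

lemma ball_subset_compl_lerch_cut: "ball 0 1 \<subseteq> - lerch_cut"
proof
  fix z :: complex assume "z \<in> ball 0 1"
  then show "z \<in> - lerch_cut" using complex_Re_le_cmod[of z] by (auto simp: lerch_cut_eq)
qed

text \<open>
  The complement of the cut is star-shaped about the origin. This makes it connected and keeps the
  denominators \<open>1 - z x\<close> away from zero for \<open>0 \<le> x \<le> 1\<close>.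
\<close>

lemma scale_notin_lerch_cut:
  assumes "z \<notin> lerch_cut" "0 \<le> u" "u \<le> 1"
  shows "of_real u * z \<notin> lerch_cut"
proof
  assume "of_real u * z \<in> lerch_cut"
  then have 1: "u * Re z \<ge> 1" "u * Im z = 0" by (auto simp: lerch_cut_eq)
  then have "u > 0" "Im z = 0" using assms(2) by (auto simp: less_eq_real_def)
  moreover have "Re z \<ge> 1" using 1(1) assms(2,3) by (smt (verit) mult_left_le_one_le mult_nonneg_nonpos)
  ultimately show False using assms(1) by (auto simp: lerch_cut_eq)
qed

lemma connected_compl_lerch_cut: "connected (- lerch_cut)"
proof (rule starlike_imp_connected)
  show "starlike (- lerch_cut)"
    unfolding starlike_def
  proof (intro bexI[of _ 0] ballI subsetI)
    fix z w assume "z \<in> - lerch_cut" "w \<in> closed_segment 0 z"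
    then show "w \<in> - lerch_cut" using scale_notin_lerch_cut
      by (auto simp: in_segment scaleR_conv_of_real)
  qed (auto simp: lerch_cut_eq)
qed

text \<open>
  The local majorant for the integral representation comes from this bound, with \<open>x\<close> in the role
  of \<open>exp (- t)\<close>; compactness makes it uniform.
\<close>

lemma one_minus_mult_bounded_below:
  assumes "z \<notin> lerch_cut"
  obtains r d where "r > 0" "d > 0" "cball z r \<subseteq> - lerch_cut"
    "\<And>w x. w \<in> cball z r \<Longrightarrow> x \<in> {0..1} \<Longrightarrow> norm (1 - w * of_real x) \<ge> d"
proof -
  obtain r where r: "r > 0" "cball z r \<subseteq> - lerch_cut"
    using open_compl_lerch_cut assms open_contains_cball by (metis ComplI)
  let ?K = "cball z r \<times> {0..1::real}"
  let ?n = "\<lambda>p. norm (1 - fst p * of_real (snd p))"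
  have "\<exists>p\<in>?K. \<forall>q\<in>?K. ?n p \<le> ?n q"
  proof (rule continuous_attains_inf)
    show "compact ?K" by (intro compact_Times) auto
    show "?K \<noteq> {}" using r by auto
    show "continuous_on ?K ?n" by (intro continuous_intros)
  qed
  then obtain p where p: "p \<in> ?K" "\<And>q. q \<in> ?K \<Longrightarrow> ?n p \<le> ?n q" by blast
  have "1 - fst p * of_real (snd p) \<noteq> 0"
  proof
    assume "1 - fst p * of_real (snd p) = 0"
    then have "of_real (snd p) * fst p \<in> lerch_cut" by (auto simp: lerch_cut_eq mult.commute)
    then show False using scale_notin_lerch_cut[of "fst p" "snd p"] p(1) r by auto
  qed
  moreover have "?n p \<le> norm (1 - w * of_real x)" if "w \<in> cball z r" "x \<in> {0..1}" for w x
    using p(2)[of "(w, x)"] that by simp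
  ultimately show ?thesis using r by (intro that[of r "?n p"]) simp_all
qed

text \<open>
  The continuation of the series in \<open>z\<close>. Convergence of the series in the disc is part of the
  notion, so that the constructions below also prove it for every \<open>s\<close> without an estimate.
\<close>

definition is_lerch :: "complex \<Rightarrow> complex \<Rightarrow> (complex \<Rightarrow> complex) \<Rightarrow> bool" where
  "is_lerch s v F \<longleftrightarrow> F holomorphic_on - lerch_cut \<and>
     (\<forall>z\<in>ball 0 1. (\<lambda>j. z ^ j / (of_nat j + v) powr s) sums F z)"

text \<open>
  Expanding \<open>1 / (1 - z exp (- t))\<close> into a geometric series and integrating term by term gives
  \<open>Gamma s\<close> times the Lerch series.
\<close>

lemma is_lerch_exists_quadrant:
  assumes s: "Re s > 0" and v: "Re v > 0"
  shows "\<exists>F. is_lerch s v F"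
proof -
  define X :: "real \<Rightarrow> real" where "X t = (if t > 0 then exp (- t) else 0)" for t
  have [measurable]: "X \<in> borel_measurable borel" unfolding X_def by measurable
  have X: "X t \<in> {0..1}" for t by (auto simp: X_def)
  let ?k = "mellin_kernel s v"
  define F where "F z = (\<integral>t. ?k t / (1 - z * of_real (X t)) \<partial>lborel)" for z
  have k: "integrable lborel ?k" by (rule mellin_kernel_integrable[OF s v])
  have "F holomorphic_on - lerch_cut"
    unfolding F_def
  proof (rule holomorphic_on_lebesgue_integral[OF open_compl_lerch_cut])
    show "(\<lambda>z. ?k t / (1 - z * of_real (X t))) holomorphic_on - lerch_cut" for t
    proof (intro holomorphic_intros)
      fix z assume "z \<in> - lerch_cut"
      then obtain r d where "r > 0" "d > 0"
        "\<And>w x. w \<in> cball z r \<Longrightarrow> x \<in> {0..1} \<Longrightarrow> norm (1 - w * of_real x) \<ge> d"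
        using one_minus_mult_bounded_below by (metis ComplD)
      from this(1,2) this(3)[of z "X t"] X[of t] show "1 - z * of_real (X t) \<noteq> 0" by auto
    qed
    fix z assume "z \<in> - lerch_cut"
    then obtain r d where rd: "r > 0" "d > 0" "cball z r \<subseteq> - lerch_cut"
        "\<And>w x. w \<in> cball z r \<Longrightarrow> x \<in> {0..1} \<Longrightarrow> norm (1 - w * of_real x) \<ge> d"
      using one_minus_mult_bounded_below by (metis ComplD)
    have "norm (?k t / (1 - w * of_real (X t))) \<le> norm (?k t) / d" if "w \<in> cball z r" for w t
      using rd(4)[OF that X] rd(2) by (simp add: norm_divide frac_le)
    then show "\<exists>r>0. \<exists>g. cball z r \<subseteq> - lerch_cut \<and> integrable lborel g \<and>
       (\<forall>w\<in>cball z r. \<forall>t\<in>space lborel. norm (?k t / (1 - w * of_real (X t))) \<le> g t)"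
      using rd(1,3) k by (intro exI[of _ r] conjI exI[of _ "\<lambda>t. norm (?k t) / d"]) auto
  qed measurable
  moreover have "(\<lambda>j. Gamma s * (z ^ j / (of_nat j + v) powr s)) sums F z" if z: "z \<in> ball 0 1" for z
  proof -
    define f where "f j t = z ^ j * mellin_kernel s (of_nat j + v) t" for j t
    have f: "f j t = ?k t * (z * of_real (X t)) ^ j" for j t
      by (auto simp: f_def X_def mellin_kernel_def power_mult_distrib algebra_simps exp_diff exp_add
          exp_minus exp_of_real exp_of_nat_mult power_divide field_simps simp flip: exp_of_real)
    have zX: "norm (z * of_real (X t)) \<le> norm z" for t
      using X[of t] by (auto simp: norm_mult mult_left_le)
    have zX1: "norm (z * of_real (X t)) < 1" for t using zX[of t] z by auto
    have nf: "norm (f j t) \<le> norm z ^ j * norm (?k t)" for j t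
      using mult_right_mono[OF power_mono[OF zX[of t], of j], of "norm (?k t)"]
      by (simp add: f norm_mult norm_power mult.commute)
    have int: "integrable lborel (f j)" for j unfolding f_def
      by (intro integrable_mult_right mellin_kernel_integrable) (use s v in auto)
    have "(\<lambda>j. \<integral>t. f j t \<partial>lborel) sums (\<integral>t. (\<Sum>j. f j t) \<partial>lborel)"
    proof (rule sums_integral[OF int])
      show "AE t in lborel. summable (\<lambda>j. norm (f j t))"
      proof (rule AE_I2)
        fix t
        have "summable (\<lambda>j. norm (?k t) * norm (z * of_real (X t)) ^ j)"
          by (intro summable_mult summable_geometric) (use zX1[of t] in auto)
        then show "summable (\<lambda>j. norm (f j t))" by (simp only: f norm_mult norm_power)
      qed
      show "summable (\<lambda>j. \<integral>t. norm (f j t) \<partial>lborel)"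
      proof (rule summable_comparison_test')
        show "summable (\<lambda>j. norm z ^ j * (\<integral>t. norm (?k t) \<partial>lborel))"
          by (intro summable_mult2 summable_geometric) (use z in auto)
        fix j
        have "(\<integral>t. norm (f j t) \<partial>lborel) \<le> (\<integral>t. norm z ^ j * norm (?k t) \<partial>lborel)"
          by (intro integral_mono) (use int k nf in auto)
        then show "norm (\<integral>t. norm (f j t) \<partial>lborel) \<le> norm z ^ j * (\<integral>t. norm (?k t) \<partial>lborel)"
          by simp
      qed
    qed
    moreover have "(\<Sum>j. f j t) = ?k t / (1 - z * of_real (X t))" for t
      using suminf_mult[OF summable_geometric[OF zX1], of "?k t" t] suminf_geometric[OF zX1, of t]
      by (simp add: f divide_inverse)
    moreover have "(\<integral>t. f j t \<partial>lborel) = Gamma s * (z ^ j / (of_nat j + v) powr s)" for j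
      using mellin_kernel_integral[of s "of_nat j + v"] s v by (simp add: f_def powr_minus_divide)
    ultimately show ?thesis by (simp only: F_def)
  qed
  moreover have Gamma_nz: "Gamma s \<noteq> 0" using s by (auto simp: Gamma_eq_zero_iff elim!: nonpos_Ints_cases)
  moreover have "(\<lambda>j. z ^ j / (of_nat j + v) powr s) sums (F z / Gamma s)"
    if "(\<lambda>j. Gamma s * (z ^ j / (of_nat j + v) powr s)) sums F z" for z
    using sums_divide[OF that, of "Gamma s"] Gamma_nz by simp
  ultimately have "is_lerch s v (\<lambda>z. F z / Gamma s)"
    unfolding is_lerch_def by (intro conjI ballI holomorphic_intros) auto
  then show ?thesis by (rule exI[of _ "\<lambda>z. F z / Gamma s"])
qed

text \<open>
  The operator \<open>z d/dz + v\<close> multiplies the \<open>j\<close>-th term by \<open>j + v\<close>, that is, it lowers \<open>s\<close> by one.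
\<close>

lemma is_lerch_lower:
  assumes F: "is_lerch s v F"
  shows "is_lerch (s - 1) v (\<lambda>z. z * deriv F z + v * F z)"
  unfolding is_lerch_def
proof (intro conjI ballI)
  have hol: "F holomorphic_on - lerch_cut" using F by (simp add: is_lerch_def)
  then show "(\<lambda>z. z * deriv F z + v * F z) holomorphic_on - lerch_cut"
    by (intro holomorphic_intros open_compl_lerch_cut)
  fix z :: complex assume z: "z \<in> ball 0 1"
  obtain r where r: "norm z < r" "r < 1" using z dense[of "norm z" 1] by auto
  define a where "a j = 1 / (of_nat j + v) powr s" for j
  have sm: "(\<lambda>j. a j * w ^ j) sums F w" if "w \<in> ball 0 1" for w
    using F that by (auto simp: is_lerch_def a_def)
  have "summable (\<lambda>j. a j * of_real (r ^ j))"
    using sm[of "of_real r"] r norm_ge_zero[of z] by (simp add: sums_iff)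
  from power_series_and_derivative_0[of a r, OF this] obtain g g' where g:
    "\<And>w. norm w < r \<Longrightarrow> (\<lambda>j. a j * w ^ j) sums g w \<and> (\<lambda>j. of_nat j * a j * w ^ (j - 1)) sums g' w \<and>
       (g has_field_derivative g' w) (at w)" by blast
  have Fg: "F w = g w" if "norm w < r" for w
    using sums_unique2[OF sm conjunct1[OF g[OF that]]] that r(2) by simp
  have "(F has_field_derivative g' z) (at z)"
    by (rule has_field_derivative_transform_within_open[of g _ _ "ball 0 r"])
       (simp_all add: g[OF r(1)] r(1) Fg)
  then have "deriv F z = g' z" by (rule DERIV_imp_deriv)
  then have "(\<lambda>j. z * (of_nat j * a j * z ^ (j - 1)) + v * (a j * z ^ j)) sums (z * deriv F z + v * F z)"
    unfolding \<open>deriv F z = g' z\<close> using g[OF r(1)] sm[OF z] by (intro sums_add sums_mult) simp_all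
  moreover have "z * (of_nat j * a j * z ^ (j - 1)) + v * (a j * z ^ j) = z ^ j / (of_nat j + v) powr (s - 1)" for j
  proof (cases "of_nat j + v = 0")
    case True
    then show ?thesis by (simp add: a_def)
  next
    case False
    then show ?thesis by (cases j) (auto simp: a_def powr_diff field_simps)
  qed
  ultimately show "(\<lambda>j. z ^ j / (of_nat j + v) powr (s - 1)) sums (z * deriv F z + v * F z)" by simp
qed

lemma is_lerch_shift:
  assumes "is_lerch s (v + 1) F"
  shows "is_lerch s v (\<lambda>z. 1 / v powr s + z * F z)"
  unfolding is_lerch_def
proof (intro conjI ballI)
  show "(\<lambda>z. 1 / v powr s + z * F z) holomorphic_on - lerch_cut"
    using assms by (auto simp: is_lerch_def intro!: holomorphic_intros)
  fix z :: complex assume "z \<in> ball 0 1"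
  then have "(\<lambda>j. z * (z ^ j / (of_nat j + (v + 1)) powr s)) sums (z * F z)"
    using assms by (intro sums_mult) (auto simp: is_lerch_def)
  then have "(\<lambda>j. z ^ Suc j / (of_nat (Suc j) + v) powr s) sums (z * F z)"
    by (simp add: algebra_simps)
  from sums_Suc[OF this] show "(\<lambda>j. z ^ j / (of_nat j + v) powr s) sums (1 / v powr s + z * F z)"
    by (simp add: add.commute)
qed

lemma pos_Re_notin_nonpos_Ints: "Re v > 0 \<Longrightarrow> v \<notin> \<int>\<^sub>\<le>\<^sub>0"
  by (auto elim!: nonpos_Ints_cases)

lemma plus_1_notin_nonpos_Ints: "v \<notin> \<int>\<^sub>\<le>\<^sub>0 \<Longrightarrow> v + 1 \<notin> (\<int>\<^sub>\<le>\<^sub>0 :: complex set)"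
  using nonpos_Ints_diff_Nats[of "v + 1" 1] by auto

text \<open>
  Properties that pass from \<open>v + 1\<close> to \<open>v\<close> need only be shown far to the right.
\<close>

lemma shift_to_halfplane_induct [consumes 1, case_names halfplane shift]:
  fixes v :: complex
  assumes "v \<notin> \<int>\<^sub>\<le>\<^sub>0"
    and half: "\<And>v. Re v > c \<Longrightarrow> v \<notin> \<int>\<^sub>\<le>\<^sub>0 \<Longrightarrow> P v"
    and shift: "\<And>v. v \<notin> \<int>\<^sub>\<le>\<^sub>0 \<Longrightarrow> P (v + 1) \<Longrightarrow> P v"
  shows "P v"
proof -
  obtain n where "real n > c - Re v" using reals_Archimedean2 by blast
  then have "Re v + real n > c" by simp
  then show ?thesis using assms(1)
  proof (induction n arbitrary: v)
    case 0
    then show ?case by (intro half) auto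
  next
    case (Suc n)
    have "P (v + 1)"
      by (rule Suc.IH) (use Suc.prems(1) plus_1_notin_nonpos_Ints[OF Suc.prems(2)] in \<open>simp_all add: algebra_simps\<close>)
    then show ?case by (rule shift[OF Suc.prems(2)])
  qed
qed

lemma is_lerch_exists:
  assumes "v \<notin> \<int>\<^sub>\<le>\<^sub>0"
  shows "\<exists>F. is_lerch s v F"
  using assms
proof (induction v rule: shift_to_halfplane_induct[where c = 0])
  case (halfplane v)
  obtain n where "real n > - Re s" using reals_Archimedean2 by blast
  then have "Re s + real n > 0" by simp
  then show ?case
  proof (induction n arbitrary: s)
    case 0
    then show ?case using halfplane by (intro is_lerch_exists_quadrant) auto
  next
    case (Suc n)
    then have "\<exists>F. is_lerch (s + 1) v F" by (intro Suc.IH) auto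
    then show ?case using is_lerch_lower[of "s + 1" v] by auto
  qed
next
  case (shift v)
  then show ?case using is_lerch_shift by blast
qed

lemma is_lerch_unique:
  assumes F: "is_lerch s v F" and G: "G holomorphic_on - lerch_cut" "\<And>z. z \<in> ball 0 1 \<Longrightarrow> G z = lerch_series z s v"
    and z: "z \<notin> lerch_cut"
  shows "F z = G z"
proof (rule analytic_continuation_open[where f = F and g = G, OF open_ball open_compl_lerch_cut _
      connected_compl_lerch_cut ball_subset_compl_lerch_cut])
  show "F holomorphic_on - lerch_cut" using F by (simp add: is_lerch_def)
  show "G holomorphic_on - lerch_cut" by (rule G(1))
  show "F w = G w" if "w \<in> ball (0::complex) 1" for w
    using F that by (simp add: is_lerch_def lerch_series_def sums_iff G(2)[OF that])
  show "z \<in> - lerch_cut" using z by simp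
qed simp

text \<open>
  The branch of \<open>lerch_phi\<close> that is continued in \<open>z\<close>, considered also where \<open>lerch_phi\<close> is given
  by the series.
\<close>

definition lerch_cont :: "complex \<Rightarrow> complex \<Rightarrow> complex \<Rightarrow> complex" where
  "lerch_cont s v = continuation (\<lambda>w. lerch_series w s v) (ball 0 1) (- lerch_cut)"

lemma is_lerch_cont:
  assumes "v \<notin> \<int>\<^sub>\<le>\<^sub>0"
  shows "is_lerch s v (lerch_cont s v)"
proof -
  obtain F where F: "is_lerch s v F" using is_lerch_exists[OF assms] by blast
  have Fs: "F w = lerch_series w s v" if "w \<in> ball 0 1" for w
    using F that by (simp add: is_lerch_def lerch_series_def sums_iff)
  have "lerch_cont s v holomorphic_on - lerch_cut \<and>
      (\<forall>w\<in>ball 0 1. lerch_cont s v w = lerch_series w s v)"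
    unfolding lerch_cont_def continuation_def
    by (rule someI[of _ F]) (use F Fs in \<open>simp add: is_lerch_def\<close>)
  then show ?thesis using F by (simp add: is_lerch_def Fs)
qed

lemma lerch_cont_eqI:
  assumes "is_lerch s v F" "z \<notin> lerch_cut" "v \<notin> \<int>\<^sub>\<le>\<^sub>0"
  shows "lerch_cont s v z = F z"
proof (rule is_lerch_unique[OF is_lerch_cont[OF assms(3)] _ _ assms(2)])
  show "F w = lerch_series w s v" if "w \<in> ball 0 1" for w
    using assms(1) that by (simp add: is_lerch_def lerch_series_def sums_iff)
qed (use assms(1) in \<open>simp add: is_lerch_def\<close>)

section \<open>Continuation in the variable s by descent\<close>

text \<open>
  Functions that are holomorphic in \<open>s\<close> on a right half-plane and depend on a parameter
  \<open>u = (z, v)\<close> in \<open>V\<close>. Joint continuity is included because holomorphy in \<open>s\<close> alone would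
  not survive the integration over \<open>v\<close>.
\<close>

definition holomorphic_family :: "real \<Rightarrow> (complex \<times> complex) set \<Rightarrow> (complex \<Rightarrow> complex \<times> complex \<Rightarrow> complex) \<Rightarrow> bool" where
  "holomorphic_family c V f \<longleftrightarrow> continuous_on ({s. Re s > c} \<times> V) (\<lambda>(s, u). f s u) \<and>
     (\<forall>u\<in>V. (\<lambda>s. f s u) holomorphic_on {s. Re s > c})"

lemma holomorphic_family_cong:
  assumes "holomorphic_family c V f" "c \<le> c'" "\<And>s u. Re s > c' \<Longrightarrow> u \<in> V \<Longrightarrow> f s u = g s u"
  shows "holomorphic_family c' V g"
proof -
  have "continuous_on ({s. Re s > c'} \<times> V) (\<lambda>(s, u). f s u)"
    using assms(1,2) by (auto simp: holomorphic_family_def elim!: continuous_on_subset)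
  then have "continuous_on ({s. Re s > c'} \<times> V) (\<lambda>(s, u). g s u)"
    by (rule continuous_on_eq) (use assms(3) in auto)
  moreover have "(\<lambda>s. g s u) holomorphic_on {s. Re s > c'}" if "u \<in> V" for u
  proof (rule holomorphic_transform)
    show "(\<lambda>s. f s u) holomorphic_on {s. Re s > c'}"
      using assms(1,2) that by (auto simp: holomorphic_family_def elim!: holomorphic_on_subset)
  qed (use assms(3) that in auto)
  ultimately show ?thesis by (simp add: holomorphic_family_def)
qed

text \<open>
  If \<open>f\<close> is a fixed point of an operator that computes the value at \<open>s\<close> from values at \<open>s + 1\<close>, then
  the iterates of the operator on \<open>f\<close> are defined on larger and larger half-planes and agree where two
  of them are; their union is the extension.
\<close>

lemma holomorphic_family_extend:
  assumes f: "holomorphic_family c V f"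
    and step: "\<And>c f. holomorphic_family c V f \<Longrightarrow> holomorphic_family (c - 1) V (R f)"
    and loc: "\<And>f g s u. (\<And>u. u \<in> V \<Longrightarrow> f (s + 1) u = g (s + 1) u) \<Longrightarrow> u \<in> V \<Longrightarrow> R f s u = R g s u"
    and recur: "\<And>s u. Re s > c \<Longrightarrow> u \<in> V \<Longrightarrow> R f s u = f s u"
  shows "\<exists>T. (\<forall>c'. holomorphic_family c' V T) \<and> (\<forall>s u. Re s > c \<longrightarrow> u \<in> V \<longrightarrow> T s u = f s u)"
proof -
  define F where "F n = (R ^^ n) f" for n
  have good: "holomorphic_family (c - real n) V (F n)" for n
  proof (induction n)
    case (Suc n)
    from step[OF Suc] show ?case by (simp add: F_def algebra_simps)
  qed (use f in \<open>simp add: F_def\<close>)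
  have suc: "F (Suc n) s u = F n s u" if "Re s > c - real n" "u \<in> V" for n s u
    using that
  proof (induction n arbitrary: s u)
    case (Suc n)
    have "R (F (Suc n)) s u = R (F n) s u"
      by (rule loc) (use Suc in auto)
    then show ?case by (simp add: F_def)
  qed (use recur in \<open>simp add: F_def\<close>)
  have mono: "F (n + k) s u = F n s u" if "Re s > c - real n" "u \<in> V" for n k s u
  proof (induction k)
    case (Suc k)
    then show ?case using suc[of "n + k" s u] that by simp
  qed simp
  have eq: "F m s u = F n s u" if "Re s > c - real n" "Re s > c - real m" "u \<in> V" for n m s u
    using mono[of n s u "m - n"] mono[of m s u "n - m"] that by (cases "n \<le> m") auto
  define N where "N s = nat (\<lceil>c - Re s\<rceil> + 1)" for s
  have N: "Re s > c - real (N s)" for s unfolding N_def by linarith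
  define T where "T s = F (N s) s" for s
  have T: "T s u = F n s u" if "Re s > c - real n" "u \<in> V" for s u n
    unfolding T_def using eq[OF that(1) N that(2)] .
  have "holomorphic_family c' V T" for c'
  proof -
    obtain n where "real n > c - c'" using reals_Archimedean2 by blast
    then show ?thesis using holomorphic_family_cong[OF good[of n], of c' T] T[of n] by force
  qed
  moreover have "T s u = f s u" if "Re s > c" "u \<in> V" for s u
    using T[of 0 s u] that by (simp add: F_def)
  ultimately show ?thesis by blast
qed

text \<open>
  The integral operator that occurs in both descent relations, with a weight \<open>\<kappa>\<close>.
\<close>

lemma holomorphic_family_integral_shift:
  assumes f: "holomorphic_family c V f" and \<kappa>: "continuous_on {0..1} \<kappa>"
    and V: "\<And>z v y. (z, v) \<in> V \<Longrightarrow> y \<in> {0..1} \<Longrightarrow> (z, v + of_real y) \<in> V"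
  shows "holomorphic_family (c - 1) V (\<lambda>s u. integral {0..1} (\<lambda>y. \<kappa> y * f (s + 1) (fst u, snd u + of_real y)))"
  unfolding holomorphic_family_def
proof (intro conjI ballI)
  have cf: "continuous_on ({s. Re s > c} \<times> V) (\<lambda>(s, u). f s u)" using f by (simp add: holomorphic_family_def)
  have cont: "continuous_on (({s. Re s > c - 1} \<times> V) \<times> cbox 0 1)
         (\<lambda>(p, y). \<kappa> y * f (fst p + 1) (fst (snd p), snd (snd p) + of_real y))"
  proof -
    have "continuous_on (({s. Re s > c - 1} \<times> V) \<times> cbox 0 (1::real))
            (\<lambda>q. (\<lambda>(s, u). f s u) (fst (fst q) + 1, (fst (snd (fst q)), snd (snd (fst q)) + of_real (snd q))))"
      by (rule continuous_on_compose2[OF cf]) (use V in \<open>auto intro!: continuous_intros\<close>)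
    moreover have "continuous_on (({s. Re s > c - 1} \<times> V) \<times> cbox 0 (1::real)) (\<lambda>q. \<kappa> (snd q))"
      by (rule continuous_on_compose2[OF \<kappa>]) (auto intro!: continuous_intros)
    ultimately show ?thesis by (auto simp: case_prod_beta intro!: continuous_intros)
  qed
  from integral_continuous_on_param[OF cont]
  show "continuous_on ({s. Re s > c - 1} \<times> V)
          (\<lambda>(s, u). integral {0..1} (\<lambda>y. \<kappa> y * f (s + 1) (fst u, snd u + of_real y)))"
    by (simp add: case_prod_beta)
  fix u assume u: "u \<in> V"
  let ?S = "{s. Re s > c - 1}" and ?M = "lebesgue_on {0..1::real}"
  let ?h = "\<lambda>s y. \<kappa> y * f (s + 1) (fst u, snd u + of_real y)"
  have V': "(fst u, snd u + of_real y) \<in> V" if "y \<in> {0..1}" for y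
    using V[of "fst u" "snd u"] u that by simp
  have op: "open ?S" by (rule open_halfspace_Re_gt)
  have ch: "continuous_on (?S \<times> {0..1}) (\<lambda>(s, y). ?h s y)"
  proof -
    have "continuous_on (?S \<times> {0..1}) (\<lambda>q. (\<lambda>(p, y). \<kappa> y * f (fst p + 1) (fst (snd p), snd (snd p) + of_real y))
             ((fst q, u), snd q))"
      by (rule continuous_on_compose2[OF cont]) (use u in \<open>auto intro!: continuous_intros\<close>)
    then show ?thesis by (simp add: case_prod_beta)
  qed
  have chs: "continuous_on {0..1} (?h s)" if "s \<in> ?S" for s
  proof -
    have "continuous_on {0..1} (\<lambda>y. (\<lambda>(s, y). ?h s y) (s, y))"
      by (rule continuous_on_compose2[OF ch]) (use that in \<open>auto intro!: continuous_intros\<close>)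
    then show ?thesis by simp
  qed
  have int: "integrable ?M (?h s)" if "s \<in> ?S" for s
    using absolutely_integrable_continuous_real[OF chs[OF that]]
    by (simp add: set_integrable_def integrable_restrict_space)
  have "(\<lambda>s. \<integral>y. ?h s y \<partial>?M) holomorphic_on ?S"
  proof (rule holomorphic_on_lebesgue_integral[OF op])
    show "(\<lambda>s. ?h s y) holomorphic_on ?S" if "y \<in> space ?M" for y
    proof -
      have "y \<in> {0..1}" using that by simp
      then have "(\<lambda>s. f s (fst u, snd u + of_real y)) holomorphic_on {s. Re s > c}"
        using f V' by (simp add: holomorphic_family_def)
      then have "((\<lambda>s. f s (fst u, snd u + of_real y)) \<circ> (\<lambda>s. s + 1)) holomorphic_on ?S"
        by (rule holomorphic_on_compose_gen[rotated]) (auto intro!: holomorphic_intros)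
      then have "(\<lambda>s. f (s + 1) (fst u, snd u + of_real y)) holomorphic_on ?S"
        by (simp add: o_def)
      then show ?thesis by (intro holomorphic_intros)
    qed
    show "?h s \<in> borel_measurable ?M" if "s \<in> ?S" for s using int[OF that] by auto
    fix z assume z: "z \<in> ?S"
    then obtain r where r: "r > 0" "cball z r \<subseteq> ?S" using op open_contains_cball by blast
    have "compact ((\<lambda>(s, y). ?h s y) ` (cball z r \<times> {0..1}))"
      by (intro compact_continuous_image compact_Times continuous_on_subset[OF ch]) (use r in auto)
    then have "bounded ((\<lambda>(s, y). ?h s y) ` (cball z r \<times> {0..1}))" by (rule compact_imp_bounded)
    then obtain B where "\<forall>x \<in> (\<lambda>(s, y). ?h s y) ` (cball z r \<times> {0..1}). norm x \<le> B"
      unfolding bounded_iff by (elim exE)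
    then have B: "\<forall>s\<in>cball z r. \<forall>y\<in>space ?M. norm (?h s y) \<le> B" by simp
    have "integrable ?M (\<lambda>_. B)"
      by (intro finite_measure.integrable_const finite_measure_lebesgue_on) simp
    then show "\<exists>r>0. \<exists>g. cball z r \<subseteq> ?S \<and> integrable ?M g \<and> (\<forall>w\<in>cball z r. \<forall>y\<in>space ?M. norm (?h w y) \<le> g y)"
      by (intro exI[of _ r] conjI exI[of _ "\<lambda>_. B"] r B)
  qed
  then show "(\<lambda>s. integral {0..1} (?h s)) holomorphic_on ?S"
    by (rule holomorphic_transform) (simp add: lebesgue_integral_eq_integral[OF int])
qed

lemma holomorphic_family_powr:
  assumes "\<And>z v. (z, v) \<in> V \<Longrightarrow> Re v > 0"
  shows "holomorphic_family c V (\<lambda>s u. snd u powr (a - s))"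
  unfolding holomorphic_family_def
proof (intro conjI ballI)
  have pos: "Re (snd u) > 0" if "u \<in> V" for u using assms[of "fst u" "snd u"] that by simp
  show "continuous_on ({s. c < Re s} \<times> V) (\<lambda>(s, u). snd u powr (a - s))"
    unfolding case_prod_beta
    by (intro continuous_on_powr_complex continuous_intros) (use pos in \<open>force simp: less_imp_le\<close>)+
  fix u assume "u \<in> V"
  then have "snd u \<noteq> 0" using pos by fastforce
  then show "(\<lambda>s. snd u powr (a - s)) holomorphic_on {s. c < Re s}"
    by (intro holomorphic_intros)
qed

lemma holomorphic_family_algebra:
  assumes f: "holomorphic_family c V f" and g: "holomorphic_family c V g"
  shows "holomorphic_family c V (\<lambda>s u. f s u + g s u)" "holomorphic_family c V (\<lambda>s u. f s u * g s u)"
  using assms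
  by (auto simp: holomorphic_family_def case_prod_beta intro!: continuous_intros holomorphic_intros)

lemma holomorphic_family_entire:
  assumes "\<And>c. holomorphic_family c V T" "u \<in> V"
  shows "(\<lambda>s. T s u) holomorphic_on A"
proof (rule holomorphic_on_subset[OF _ subset_UNIV], rule holomorphic_onI)
  fix s :: complex
  have "(\<lambda>s. T s u) holomorphic_on {s'. Re s' > Re s - 1}"
    using assms(1)[of "Re s - 1"] assms(2) unfolding holomorphic_family_def by blast
  then show "(\<lambda>s. T s u) field_differentiable (at s within UNIV)"
    by (rule holomorphic_on_imp_differentiable_at[OF _ open_halfspace_Re_gt]) simp
qed

lemma holomorphic_family_factor:
  assumes "continuous_on V h"
  shows "holomorphic_family c V (\<lambda>s u. (a * s + b) * h u)"
proof -
  have "continuous_on ({s. Re s > c} \<times> V) (\<lambda>p. h (snd p))"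
    by (rule continuous_on_compose2[OF assms]) (auto intro!: continuous_intros)
  then show ?thesis
    by (auto simp: holomorphic_family_def case_prod_beta intro!: continuous_intros holomorphic_intros)
qed

section \<open>The Lerch series on the closed unit disc\<close>

text \<open>
  The imaginary part of \<open>s\<close> changes the norm of a power by a factor of at most \<open>exp (pi * \<bar>Im s\<bar>)\<close>, as arguments
  are bounded by \<open>pi\<close>. With \<open>Re v > 1\<close> all bases have norm at least one, so that the bound is monotone
  in the real part of \<open>s\<close>.
\<close>

lemma norm_powr_shifted_ge:
  fixes s v :: complex
  assumes "Re v > 1" "Re s \<ge> \<sigma>" "\<sigma> \<ge> 0" "\<bar>Im s\<bar> \<le> B"
  shows "norm ((of_nat j + v) powr s) \<ge> (real j + 1) powr \<sigma> * exp (- pi * B)"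
proof -
  let ?w = "of_nat j + v"
  have w: "norm ?w \<ge> real j + 1"
    using complex_Re_le_cmod[of ?w] assms(1) by simp
  have "(real j + 1) powr \<sigma> \<le> (real j + 1) powr Re s"
    using assms by (intro powr_mono) auto
  also have "\<dots> \<le> norm ?w powr Re s"
    using assms w by (intro powr_mono2) auto
  finally have 1: "(real j + 1) powr \<sigma> \<le> norm ?w powr Re s" .
  have "Im s * Arg ?w \<le> \<bar>Im s\<bar> * \<bar>Arg ?w\<bar>" by (simp flip: abs_mult)
  also have "\<dots> \<le> B * pi"
    using assms(4) Arg_le_pi[of ?w] mpi_less_Arg[of ?w] by (intro mult_mono) auto
  finally have 2: "exp (- pi * B) \<le> exp (- Im s * Arg ?w)" by (simp add: mult.commute)
  show ?thesis unfolding norm_powr_complex using 1 2 by (intro mult_mono) auto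
qed

lemma norm_lerch_term_le:
  assumes "norm z \<le> 1" "Re v > 1" "Re s \<ge> \<sigma>" "\<sigma> \<ge> 0" "\<bar>Im s\<bar> \<le> B"
  shows "norm (z ^ j / (of_nat j + v) powr s) \<le> exp (pi * B) * (real j + 1) powr - \<sigma>"
proof -
  have "norm (z ^ j / (of_nat j + v) powr s) \<le> 1 / ((real j + 1) powr \<sigma> * exp (- pi * B))"
    unfolding norm_divide norm_power
    by (intro frac_le norm_powr_shifted_ge assms) (use assms(1) in \<open>auto simp: power_le_one\<close>)
  then show ?thesis by (simp add: powr_minus exp_minus field_simps)
qed

lemma summable_majorant:
  assumes "\<sigma> > 1"
  shows "summable (\<lambda>j. C * (real j + 1) powr - \<sigma>)"
proof -
  have "summable (\<lambda>j. real (Suc j) powr - \<sigma>)"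
    using assms by (subst summable_Suc_iff) (simp add: summable_real_powr_iff)
  then show ?thesis by (intro summable_mult) (simp add: add.commute)
qed

lemma lerch_series_sums_halfplane:
  assumes "norm z \<le> 1" "Re v > 1" "Re s > 1"
  shows "(\<lambda>j. z ^ j / (of_nat j + v) powr s) sums lerch_series z s v"
proof -
  have "summable (\<lambda>j. z ^ j / (of_nat j + v) powr s)"
  proof (rule summable_comparison_test')
    show "summable (\<lambda>j. exp (pi * \<bar>Im s\<bar>) * (real j + 1) powr - Re s)"
      by (rule summable_majorant[OF assms(3)])
    show "norm (z ^ j / (of_nat j + v) powr s) \<le> exp (pi * \<bar>Im s\<bar>) * (real j + 1) powr - Re s" for j
      by (rule norm_lerch_term_le) (use assms in auto)
  qed
  then show ?thesis unfolding lerch_series_def by (rule summable_sums)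
qed

text \<open>
  Convergence does not depend on finitely many terms, so it is inherited from the half-plane
  \<open>Re v > 1\<close>.
\<close>

lemma lerch_series_sums:
  assumes "v \<notin> \<int>\<^sub>\<le>\<^sub>0" "norm z \<le> 1" "Re s > 1"
  shows "(\<lambda>j. z ^ j / (of_nat j + v) powr s) sums lerch_series z s v"
proof -
  have "summable (\<lambda>j. z ^ j / (of_nat j + v) powr s)"
    using assms(1)
  proof (induction v rule: shift_to_halfplane_induct[where c = 1])
    case (halfplane v)
    then show ?case using lerch_series_sums_halfplane[of z v s] assms by (simp add: sums_iff)
  next
    case (shift v)
    have "summable (\<lambda>j. z * (z ^ j / (of_nat j + (v + 1)) powr s))"
      by (intro summable_mult shift)
    then have "summable (\<lambda>j. z ^ Suc j / (of_nat (Suc j) + v) powr s)"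
      by (simp add: algebra_simps)
    then show ?case by (subst (asm) summable_Suc_iff)
  qed
  then show ?thesis unfolding lerch_series_def by (rule summable_sums)
qed

lemma lerch_series_shift:
  assumes "v \<notin> \<int>\<^sub>\<le>\<^sub>0" "norm z \<le> 1" "Re s > 1"
  shows "lerch_series z s v = 1 / v powr s + z * lerch_series z s (v + 1)"
proof -
  have "(\<lambda>j. z * (z ^ j / (of_nat j + (v + 1)) powr s)) sums (z * lerch_series z s (v + 1))"
    by (intro sums_mult lerch_series_sums assms plus_1_notin_nonpos_Ints)
  then have "(\<lambda>j. z ^ Suc j / (of_nat (Suc j) + v) powr s) sums (z * lerch_series z s (v + 1))"
    by (simp add: algebra_simps)
  from sums_Suc[OF this]
  have "(\<lambda>j. z ^ j / (of_nat j + v) powr s) sums (1 / v powr s + z * lerch_series z s (v + 1))"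
    by (simp add: add.commute)
  then show ?thesis using lerch_series_sums[OF assms] by (rule sums_unique2[symmetric])
qed

text \<open>
  Uniformity in all three variables at once; the joint continuity of the limit rests on it.
\<close>

lemma uniform_limit_lerch_series:
  assumes "\<sigma> > 1"
  shows "uniform_limit ({s. Re s \<ge> \<sigma> \<and> \<bar>Im s\<bar> \<le> B} \<times> (cball 0 1 \<times> {v. Re v > 1}))
           (\<lambda>n (s, z, v). \<Sum>j<n. z ^ j / (of_nat j + v) powr s) (\<lambda>(s, z, v). lerch_series z s v) sequentially"
  unfolding lerch_series_def case_prod_beta
proof (rule Weierstrass_m_test)
  show "summable (\<lambda>j. exp (pi * B) * (real j + 1) powr - \<sigma>)" by (rule summable_majorant[OF assms])
qed (use assms in \<open>auto intro!: norm_lerch_term_le\<close>)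

lemma continuous_on_locally:
  assumes "\<And>x. x \<in> S \<Longrightarrow> \<exists>N. open N \<and> x \<in> N \<and> continuous_on (S \<inter> N) f"
  shows "continuous_on S f"
  unfolding continuous_on_def
proof
  fix x assume x: "x \<in> S"
  then obtain N where N: "open N" "x \<in> N" "continuous_on (S \<inter> N) f" using assms by blast
  then have "(f \<longlongrightarrow> f x) (at x within S \<inter> N)" using x by (simp add: continuous_on_def)
  moreover have "at x within S \<inter> N = at x within S"
    by (rule at_within_nhd[OF N(2,1)]) auto
  ultimately show "(f \<longlongrightarrow> f x) (at x within S)" by simp
qed

lemma strip_neighbourhood:
  assumes "Re s0 > c"
  obtains \<sigma> B d where "\<sigma> > c" "d > 0" "Re s0 > \<sigma>" "\<bar>Im s0\<bar> < B"
    "cball s0 d \<subseteq> {s. Re s \<ge> \<sigma> \<and> \<bar>Im s\<bar> \<le> B}"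
proof -
  define d where "d = (Re s0 - c) / 2"
  have "Re s \<ge> c + d \<and> \<bar>Im s\<bar> \<le> \<bar>Im s0\<bar> + d" if "s \<in> cball s0 d" for s
  proof -
    have "norm (s0 - s) \<le> d" using that by (simp add: dist_norm)
    then have "\<bar>Re s0 - Re s\<bar> \<le> d" "\<bar>Im s0 - Im s\<bar> \<le> d"
      using abs_Re_le_cmod[of "s0 - s"] abs_Im_le_cmod[of "s0 - s"] by auto
    moreover have "Re s0 = c + 2 * d" by (simp add: d_def field_simps)
    ultimately show ?thesis by linarith
  qed
  then show ?thesis using assms
    by (intro that[of "c + d" d "\<bar>Im s0\<bar> + d"]) (auto simp: d_def field_simps)
qed

lemma holomorphic_family_lerch_series:
  "holomorphic_family 1 (cball 0 1 \<times> {v. Re v > 1}) (\<lambda>s (z, v). lerch_series z s v)"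
  unfolding holomorphic_family_def
proof (intro conjI ballI)
  let ?V = "cball (0::complex) 1 \<times> {v::complex. Re v > 1}"
  let ?p = "\<lambda>n (s, z, v). \<Sum>j<n. z ^ j / (of_nat j + v) powr s"
  have nz: "of_nat j + v \<notin> \<real>\<^sub>\<le>\<^sub>0" if "Re v > 1" for j and v :: complex
    using that by (auto simp: complex_nonpos_Reals_iff)
  have nz0: "of_nat j + v \<noteq> 0" if "Re v > 1" for j and v :: complex
    using nz[OF that, of j] by auto
  have pc: "continuous_on (A \<times> ?V) (?p n)" for A n
    unfolding case_prod_beta
    by (intro continuous_on_sum continuous_on_divide continuous_on_powr_complex continuous_intros)
       (use nz0 in auto)
  show "continuous_on ({s. Re s > 1} \<times> ?V) (\<lambda>(s, u). case u of (z, v) \<Rightarrow> lerch_series z s v)"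
  proof (rule continuous_on_locally)
    fix x assume x: "x \<in> {s. Re s > 1} \<times> ?V"
    then have "Re (fst x) > 1" by auto
    then obtain \<sigma> B d where sB: "\<sigma> > 1" "Re (fst x) > \<sigma>" "\<bar>Im (fst x)\<bar> < B"
      by (rule strip_neighbourhood)
    let ?N = "{s. Re s > \<sigma>} \<inter> {s. \<bar>Im s\<bar> < B}"
    have "open ?N" by (intro open_Int open_Collect_less continuous_intros)
    moreover have "continuous_on (({s. Re s > 1} \<times> ?V) \<inter> (?N \<times> UNIV)) (\<lambda>(s, z, v). lerch_series z s v)"
    proof (rule continuous_on_subset)
      show "continuous_on ({s. Re s \<ge> \<sigma> \<and> \<bar>Im s\<bar> \<le> B} \<times> ?V) (\<lambda>(s, z, v). lerch_series z s v)"
        by (rule uniform_limit_theorem[OF _ uniform_limit_lerch_series[OF sB(1)]]) (use pc in auto)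
    qed auto
    ultimately show "\<exists>N. open N \<and> x \<in> N \<and> continuous_on (({s. Re s > 1} \<times> ?V) \<inter> N)
                       (\<lambda>(s, u). case u of (z, v) \<Rightarrow> lerch_series z s v)"
      using sB x by (intro exI[of _ "?N \<times> UNIV"]) (auto intro!: open_Times)
  qed
  fix u assume u: "u \<in> ?V"
  show "(\<lambda>s. case u of (z, v) \<Rightarrow> lerch_series z s v) holomorphic_on {s. Re s > 1}"
  proof (rule holomorphic_uniform_sequence[where f = "\<lambda>n s. ?p n (s, u)"])
    show "open {s. Re s > 1}" by (rule open_halfspace_Re_gt)
    show "(\<lambda>s. ?p n (s, u)) holomorphic_on {s. Re s > 1}" for n
      using u nz nz0 by (auto simp: case_prod_beta intro!: holomorphic_intros)
    fix s0 :: complex assume "s0 \<in> {s. Re s > 1}"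
    then have "Re s0 > 1" by simp
    then obtain \<sigma> B d where sB: "\<sigma> > 1" "d > 0" "cball s0 d \<subseteq> {s. Re s \<ge> \<sigma> \<and> \<bar>Im s\<bar> \<le> B}"
      by (rule strip_neighbourhood)
    have "uniform_limit (cball s0 d) (\<lambda>n s. ?p n (s, u)) (\<lambda>s. case u of (z, v) \<Rightarrow> lerch_series z s v) sequentially"
      using uniform_limit_compose'[OF uniform_limit_lerch_series[OF sB(1), of B], of "\<lambda>s. (s, u)" "cball s0 d"] sB(3) u
      by (auto simp: case_prod_beta)
    then show "\<exists>d>0. cball s0 d \<subseteq> {s. Re s > 1} \<and>
        uniform_limit (cball s0 d) (\<lambda>n s. ?p n (s, u)) (\<lambda>s. case u of (z, v) \<Rightarrow> lerch_series z s v) sequentially"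
      using sB by (intro exI[of _ d]) force
  qed
qed

text \<open>
  Termwise differentiation in \<open>v\<close>. It is the source of both descent relations.
\<close>

lemma lerch_series_derivative:
  assumes z: "norm z \<le> 1" and s: "Re s > 1" and v: "Re v > 1"
  shows "((\<lambda>v. lerch_series z s v) has_field_derivative - s * lerch_series z (s + 1) v) (at v)"
proof -
  let ?S = "{v::complex. Re v > 1}"
  let ?f' = "\<lambda>j v. - s * (z ^ j / (of_nat j + v) powr (s + 1))"
  have op: "open ?S" by (rule open_halfspace_Re_gt)
  have "((\<lambda>v. \<Sum>j. z ^ j / (of_nat j + v) powr s) has_field_derivative (\<Sum>j. ?f' j v)) (at v)"
  proof (rule has_field_derivative_series'(2)[where S = ?S and x0 = v])
    show "convex ?S" by (rule convex_halfspace_Re_gt)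
    show "((\<lambda>v. z ^ j / (of_nat j + v) powr s) has_field_derivative ?f' j w) (at w within ?S)" if w: "w \<in> ?S" for j w
    proof -
      have nz: "of_nat j + w \<notin> \<real>\<^sub>\<le>\<^sub>0" "of_nat j + w \<noteq> 0"
        using w by (auto simp: complex_nonpos_Reals_iff complex_eq_iff)
      have "((\<lambda>v. z ^ j * (of_nat j + v) powr (- s)) has_field_derivative
              z ^ j * (- s * (of_nat j + w) powr (- s - 1))) (at w within ?S)"
        using nz by (auto intro!: derivative_eq_intros)
      moreover have "(of_nat j + w) powr (- s - 1) = 1 / (of_nat j + w) powr (s + 1)"
        using powr_minus_divide[of "of_nat j + w" "s + 1"] by (simp only: minus_add_distrib diff_conv_add_uminus)
      ultimately show ?thesis by (simp add: powr_minus_divide mult.commute)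
    qed
    show "uniformly_convergent_on ?S (\<lambda>n x. \<Sum>j<n. ?f' j x)"
    proof (rule Weierstrass_m_test')
      show "summable (\<lambda>j. norm s * exp (pi * \<bar>Im s\<bar>) * (real j + 1) powr - (Re s + 1))"
        using s by (intro summable_majorant) auto
      show "norm (?f' j w) \<le> norm s * exp (pi * \<bar>Im s\<bar>) * (real j + 1) powr - (Re s + 1)" if "w \<in> ?S" for j w
      proof -
        have "norm (z ^ j / (of_nat j + w) powr (s + 1)) \<le> exp (pi * \<bar>Im s\<bar>) * (real j + 1) powr - (Re s + 1)"
          by (rule norm_lerch_term_le) (use z s that in auto)
        then show ?thesis
          unfolding norm_mult norm_minus_cancel mult.assoc by (intro mult_left_mono norm_ge_zero)
      qed
    qed
    show "summable (\<lambda>j. z ^ j / (of_nat j + v) powr s)"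
      using lerch_series_sums_halfplane[OF z v s] by (simp add: sums_iff)
    show "v \<in> interior ?S" using v op by (simp add: interior_open)
  qed (use v in auto)
  moreover have "(\<Sum>j. ?f' j v) = - s * lerch_series z (s + 1) v"
    using lerch_series_sums_halfplane[of z v "s + 1"] z s v
    by (intro sums_unique[symmetric] sums_mult) auto
  ultimately show ?thesis unfolding lerch_series_def by simp
qed

lemma lerch_series_line_derivative:
  assumes "norm z \<le> 1" "Re s > 1" "Re v > 1" "0 \<le> y"
  shows "((\<lambda>y. lerch_series z s (v + of_real y)) has_vector_derivative
            - s * lerch_series z (s + 1) (v + of_real y)) (at y within A)"
proof -
  have "((\<lambda>y. v + of_real y) has_vector_derivative 1) (at y within A)"
    by (auto intro!: derivative_eq_intros)
  from field_vector_diff_chain_within[OF this, of "\<lambda>v. lerch_series z s v" "- s * lerch_series z (s + 1) (v + of_real y)"]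
  show ?thesis
    using lerch_series_derivative[of z s "v + of_real y"] assms
    by (simp add: o_def has_field_derivative_at_within)
qed

text \<open>
  Integrating the derivative gives \<open>lerch_series z s (v + 1) - lerch_series z s v\<close>, and splitting
  off the first term eliminates the value at \<open>v + 1\<close>.
\<close>

lemma lerch_series_descent:
  assumes "norm z \<le> 1" "Re s > 1" "Re v > 1"
  shows "(1 - z) * lerch_series z s v
           = v powr - s - z * s * integral {0..1} (\<lambda>y. lerch_series z (s + 1) (v + of_real y))"
proof -
  have "((\<lambda>y. - s * lerch_series z (s + 1) (v + of_real y)) has_integral
          lerch_series z s (v + of_real 1) - lerch_series z s (v + of_real 0)) {0..1}"
  proof (rule fundamental_theorem_of_calculus)
    show "((\<lambda>y. lerch_series z s (v + of_real y)) has_vector_derivative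
            - s * lerch_series z (s + 1) (v + of_real y)) (at y within {0..1})" if "y \<in> {0..1}" for y
      by (rule lerch_series_line_derivative) (use assms that in auto)
  qed simp
  then have "- s * integral {0..1} (\<lambda>y. lerch_series z (s + 1) (v + of_real y))
              = lerch_series z s (v + 1) - lerch_series z s v"
    by (simp add: has_integral_iff)
  then show ?thesis using lerch_series_shift[of v z s] pos_Re_notin_nonpos_Ints[of v] assms
    by (simp add: powr_minus_divide algebra_simps)
qed

text \<open>
  At \<open>z = 1\<close> the preceding relation loses its left-hand side. Instead the derivative of
  \<open>- (s - 1) (1 - y) \<zeta>(s, v + y) + \<zeta>(s - 1, v + y)\<close> in \<open>y\<close> is integrated over the unit interval. The
  factor \<open>s - 1\<close> removes the pole: it turns \<open>s * \<zeta>(s + 1, v)\<close> into the same function at \<open>s + 1\<close>. The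
  stronger bound on \<open>Re s\<close> lets the series at \<open>s - 1\<close> converge.
\<close>

lemma zeta_series_descent:
  assumes "Re s > 2" "Re v > 1"
  shows "(s - 1) * lerch_series 1 s v = v powr (1 - s)
           + (s - 1) * integral {0..1} (\<lambda>y. (1 - of_real y) * (s * lerch_series 1 (s + 1) (v + of_real y)))"
proof -
  let ?L = "\<lambda>s y. lerch_series 1 s (v + of_real y)"
  have "((\<lambda>y. (s - 1) * ((1 - of_real y) * (s * ?L (s + 1) y))) has_integral
          ((s - 1) * (- (1 - of_real 1) * ?L s 1) + ?L (s - 1) 1)
          - ((s - 1) * (- (1 - of_real 0) * ?L s 0) + ?L (s - 1) 0)) {0..1}"
  proof (rule fundamental_theorem_of_calculus)
    fix y :: real assume y: "y \<in> {0..1}"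
    have 1: "(?L s has_vector_derivative - s * ?L (s + 1) y) (at y within {0..1})"
      by (rule lerch_series_line_derivative) (use assms y in auto)
    have 2: "(?L (s - 1) has_vector_derivative - (s - 1) * ?L (s - 1 + 1) y) (at y within {0..1})"
      by (rule lerch_series_line_derivative) (use assms y in auto)
    show "((\<lambda>y. (s - 1) * (- (1 - of_real y) * ?L s y) + ?L (s - 1) y) has_vector_derivative
            (s - 1) * ((1 - of_real y) * (s * ?L (s + 1) y))) (at y within {0..1})"
      by (rule derivative_eq_intros 1 2 refl)+ (simp add: algebra_simps)
  qed auto
  then have "(s - 1) * integral {0..1} (\<lambda>y. (1 - of_real y) * (s * ?L (s + 1) y))
     = lerch_series 1 (s - 1) (v + 1) + (s - 1) * lerch_series 1 s v - lerch_series 1 (s - 1) v"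
    by (simp add: has_integral_iff)
  then show ?thesis using lerch_series_shift[of v 1 "s - 1"] pos_Re_notin_nonpos_Ints[of v] assms
      powr_minus_divide[of v "s - 1"]
    by (simp add: algebra_simps)
qed

section \<open>The value at minus one as an entire function of s\<close>

lemma lerch_cont_ball:
  assumes "v \<notin> \<int>\<^sub>\<le>\<^sub>0" "norm z < 1"
  shows "(\<lambda>j. z ^ j / (of_nat j + v) powr s) sums lerch_series z s v"
    and "lerch_cont s v z = lerch_series z s v"
  using is_lerch_cont[OF assms(1), of s] assms(2)
  by (simp_all add: is_lerch_def lerch_series_def sums_iff)

text \<open>
  The polynomial growth of the coefficients, locally uniform in \<open>s\<close>, does not spoil the geometric
  decay. The summability of the majorant is read off from another Lerch series, with real arguments.
\<close>

lemma lerch_series_entire: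
  assumes z: "norm z < 1" and v: "Re v > 1"
  shows "(\<lambda>s. lerch_series z s v) holomorphic_on UNIV"
proof (rule holomorphic_uniform_sequence[where f = "\<lambda>n s. \<Sum>j<n. z ^ j / (of_nat j + v) powr s"])
  have nz: "of_nat j + v \<noteq> 0" for j using v by (auto simp: complex_eq_iff)
  show "(\<lambda>s. \<Sum>j<n. z ^ j / (of_nat j + v) powr s) holomorphic_on UNIV" for n
    using nz by (intro holomorphic_intros) auto
  fix s0 :: complex
  define r B where "r = \<bar>Re s0\<bar> + 1" and "B = \<bar>Im s0\<bar> + 1"
  define M where "M j = exp (pi * B) * (norm z ^ j * (real j + norm v) powr r)" for j
  have nv: "norm v > 0" using v by auto
  then have "complex_of_real (norm v) \<notin> \<int>\<^sub>\<le>\<^sub>0" by (intro pos_Re_notin_nonpos_Ints) simp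
  from lerch_cont_ball(1)[OF this, of "of_real (norm z)" "- of_real r"] z
  have "summable (\<lambda>j. of_real (norm z) ^ j / (of_nat j + complex_of_real (norm v)) powr (- of_real r))"
    by (simp add: sums_iff)
  moreover have "of_real (norm z) ^ j / (of_nat j + complex_of_real (norm v)) powr (- of_real r)
      = complex_of_real (norm z ^ j * (real j + norm v) powr r)" for j
    using nv powr_of_real[of "real j + norm v" r] by (simp add: powr_minus field_simps)
  ultimately have "summable (\<lambda>j. complex_of_real (norm z ^ j * (real j + norm v) powr r))" by simp
  then have M: "summable M" unfolding M_def by (intro summable_mult) (simp only: summable_of_real_iff)
  have "uniform_limit (cball s0 1) (\<lambda>n s. \<Sum>j<n. z ^ j / (of_nat j + v) powr s) (\<lambda>s. lerch_series z s v) sequentially"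
    unfolding lerch_series_def
  proof (rule Weierstrass_m_test[OF _ M])
    fix j s assume "s \<in> cball s0 1"
    then have "norm (s0 - s) \<le> 1" by (simp add: dist_norm)
    then have "\<bar>Re s0 - Re s\<bar> \<le> 1" "\<bar>Im s0 - Im s\<bar> \<le> 1"
      using abs_Re_le_cmod[of "s0 - s"] abs_Im_le_cmod[of "s0 - s"] by auto
    then have s: "- Re s \<le> r" "\<bar>Im s\<bar> \<le> B" unfolding r_def B_def by linarith+
    let ?w = "of_nat j + v"
    have w: "norm ?w \<ge> 1" using complex_Re_le_cmod[of ?w] v by simp
    have w': "norm ?w \<le> real j + norm v" using norm_triangle_ineq[of "of_nat j" v] by simp
    have "norm (1 / ?w powr s) = norm ?w powr - Re s * exp (Im s * Arg ?w)"
      using nz[of j] by (simp add: norm_divide norm_powr_complex powr_minus exp_minus field_simps)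
    also have "\<dots> \<le> (real j + norm v) powr r * exp (pi * B)"
    proof (rule mult_mono)
      have "norm ?w powr - Re s \<le> norm ?w powr r" by (rule powr_mono[OF s(1) w])
      also have "\<dots> \<le> (real j + norm v) powr r"
        by (rule powr_mono2) (use w w' in \<open>auto simp: r_def\<close>)
      finally show "norm ?w powr - Re s \<le> (real j + norm v) powr r" .
      have "Im s * Arg ?w \<le> \<bar>Im s\<bar> * \<bar>Arg ?w\<bar>" by (simp flip: abs_mult)
      also have "\<dots> \<le> B * pi"
        using s(2) Arg_le_pi[of ?w] mpi_less_Arg[of ?w] by (intro mult_mono) auto
      finally show "exp (Im s * Arg ?w) \<le> exp (pi * B)" by (simp add: mult.commute)
    qed auto
    finally have "norm z ^ j * norm (1 / ?w powr s) \<le> norm z ^ j * ((real j + norm v) powr r * exp (pi * B))"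
      by (intro mult_left_mono) auto
    then show "norm (z ^ j / ?w powr s) \<le> M j"
      by (simp add: M_def norm_divide norm_mult norm_power mult_ac)
  qed
  then show "\<exists>d>0. cball s0 d \<subseteq> UNIV \<and>
      uniform_limit (cball s0 d) (\<lambda>n s. \<Sum>j<n. z ^ j / (of_nat j + v) powr s) (\<lambda>s. lerch_series z s v) sequentially"
    by (intro exI[of _ 1]) simp
qed auto

text \<open>
  The descent relation extends the series in \<open>s\<close> for all \<open>z\<close> of the segment from \<open>- 1\<close> to \<open>0\<close> together,
  continuously in \<open>z\<close>. Inside the disc the extension is the Lerch series by the identity theorem in \<open>s\<close>.
  Letting \<open>z\<close> tend to \<open>- 1\<close> shows that the continuation in \<open>z\<close> and the extension in \<open>s\<close> have the same
  value there.
\<close>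

lemma lerch_cont_minus_1_halfplane:
  assumes v: "Re v > 1"
  shows "(\<lambda>s. lerch_cont s v (- 1)) holomorphic_on UNIV \<and>
         (\<forall>s. Re s > 1 \<longrightarrow> lerch_cont s v (- 1) = lerch_series (- 1) s v)"
proof -
  let ?V = "complex_of_real ` {-1..0} \<times> {v::complex. Re v > 1}"
  define f where "f = (\<lambda>s (z, v). lerch_series z s v)"
  define I where "I g s u = integral {0..1} (\<lambda>y. g (s + 1) (fst u, snd u + of_real y))"
    for g :: "complex \<Rightarrow> complex \<times> complex \<Rightarrow> complex" and s u
  \<comment> \<open>the coefficients are written as \<open>(a * s + b) * h u\<close>, the form of \<open>holomorphic_family_factor\<close>\<close>
  define R where "R g s u = (0 * s + 1) * (1 / (1 - fst u)) * snd u powr (0 - s)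
      + (- 1 * s + 0) * (fst u / (1 - fst u)) * I g s u" for g s u
  have ne: "1 - fst u \<noteq> 0" if "u \<in> ?V" for u
    using that by (auto simp: complex_eq_iff)
  have le: "norm (fst u) \<le> 1" if "u \<in> ?V" for u using that by auto
  have "\<exists>T. (\<forall>c'. holomorphic_family c' ?V T) \<and> (\<forall>s u. Re s > 1 \<longrightarrow> u \<in> ?V \<longrightarrow> T s u = f s u)"
  proof (rule holomorphic_family_extend[where R = R])
    have "?V \<subseteq> cball 0 1 \<times> {v. Re v > 1}" using le by force
    then show "holomorphic_family 1 ?V f"
      using holomorphic_family_lerch_series unfolding f_def holomorphic_family_def
      by (auto elim!: continuous_on_subset)
    show "holomorphic_family (c - 1) ?V (R g)" if g: "holomorphic_family c ?V g" for c g
    proof -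
      have "holomorphic_family (c - 1) ?V (\<lambda>s u. integral {0..1} (\<lambda>y. 1 * g (s + 1) (fst u, snd u + of_real y)))"
        by (rule holomorphic_family_integral_shift[OF g]) auto
      then have "holomorphic_family (c - 1) ?V (I g)" unfolding I_def by simp
      then show ?thesis unfolding R_def
        by (intro holomorphic_family_algebra holomorphic_family_factor holomorphic_family_powr)
           (use ne in \<open>auto intro!: continuous_intros\<close>)
    qed
    show "R g s u = R h s u" if "\<And>u. u \<in> ?V \<Longrightarrow> g (s + 1) u = h (s + 1) u" "u \<in> ?V" for g h s u
    proof -
      have "I g s u = I h s u" unfolding I_def
        by (rule Henstock_Kurzweil_Integration.integral_cong) (use that in auto)
      then show ?thesis by (simp add: R_def)
    qed
    show "R f s u = f s u" if "Re s > 1" "u \<in> ?V" for s u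
    proof -
      have u: "Re (snd u) > 1" using that by auto
      have "R f s u = (snd u powr - s - fst u * s * I f s u) / (1 - fst u)"
        by (simp add: R_def diff_divide_distrib)
      also have "snd u powr - s - fst u * s * I f s u = (1 - fst u) * f s u"
        using lerch_series_descent[OF le[OF that(2)] that(1) u]
        by (simp add: f_def I_def case_prod_beta)
      finally show ?thesis using ne[OF that(2)] by simp
    qed
  qed
  then obtain T where good: "\<And>c'. holomorphic_family c' ?V T"
    and Tf: "\<And>s u. Re s > 1 \<Longrightarrow> u \<in> ?V \<Longrightarrow> T s u = f s u" by blast
  have T_hol: "(\<lambda>s. T s u) holomorphic_on A" if "u \<in> ?V" for u A
    using good that by (rule holomorphic_family_entire)
  have T_series: "T s (z, v) = lerch_series z s v" if "z \<in> complex_of_real ` {-1<..0}" for z s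
  proof -
    have u: "(z, v) \<in> ?V" "norm z < 1" using that v by auto
    show ?thesis
    proof (rule analytic_continuation_open[where f = "\<lambda>s. T s (z, v)" and g = "\<lambda>s. lerch_series z s v"
          and s = "{s. Re s > 1}" and s' = UNIV])
      show "{s::complex. Re s > 1} \<noteq> {}" by (auto intro!: exI[of _ 2])
      show "T s (z, v) = lerch_series z s v" if "s \<in> {s. Re s > 1}" for s
        using Tf[of s "(z, v)"] u that by (simp add: f_def)
    qed (use T_hol[OF u(1)] lerch_series_entire[OF u(2) v] in \<open>auto simp: open_halfspace_Re_gt\<close>)
  qed
  have m1: "(- 1 :: complex) \<notin> lerch_cut" by (simp add: lerch_cut_eq)
  have v0: "v \<notin> \<int>\<^sub>\<le>\<^sub>0" using v by (intro pos_Re_notin_nonpos_Ints) simp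
  have "lerch_cont s v (- 1) = T s (- 1, v)" for s
  proof -
    \<comment> \<open>a sequence in the interior of the disc that tends to \<open>- 1\<close>\<close>
    define X where "X n = complex_of_real (- 1 + 1 / real (Suc n))" for n
    have X: "X n \<in> complex_of_real ` {-1<..0}" for n 
      unfolding X_def by (rule imageI) (simp del: of_nat_Suc)
    then have X': "X n \<in> complex_of_real ` {-1..0}" for n
      using image_mono[of "{-1<..0}" "{-1..0::real}" complex_of_real] by force
    have "X \<longlonglongrightarrow> complex_of_real (- 1 + 0)"
      unfolding X_def by (intro tendsto_of_real tendsto_add tendsto_const LIMSEQ_Suc[OF lim_1_over_n])
    then have Xl: "X \<longlonglongrightarrow> - 1" by simp
    have "isCont (lerch_cont s v) (- 1)"
      using is_lerch_cont[OF v0, of s] m1 open_compl_lerch_cut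
      by (intro continuous_on_interior[of "- lerch_cut"])
         (auto simp: is_lerch_def interior_open intro!: holomorphic_on_imp_continuous_on)
    then have 1: "(\<lambda>n. lerch_cont s v (X n)) \<longlonglongrightarrow> lerch_cont s v (- 1)"
      using Xl by (rule isCont_tendsto_compose)
    have c: "continuous_on ({s'. Re s' > Re s - 1} \<times> ?V) (\<lambda>(s, u). T s u)"
      using good[of "Re s - 1"] unfolding holomorphic_family_def by (rule conjunct1)
    have "(\<lambda>n. (\<lambda>(s, u). T s u) (s, X n, v)) \<longlonglongrightarrow> (\<lambda>(s, u). T s u) (s, - 1, v)"
    proof (rule continuous_on_tendsto_compose[OF c])
      show "(\<lambda>n. (s, X n, v)) \<longlonglongrightarrow> (s, - 1, v)" by (intro tendsto_intros Xl)
      show "(s, - 1, v) \<in> {s'. Re s' > Re s - 1} \<times> ?V" using v by (auto intro!: image_eqI[of _ _ "-1"])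
      show "\<forall>\<^sub>F n in sequentially. (s, X n, v) \<in> {s'. Re s' > Re s - 1} \<times> ?V"
        using v X' by simp
    qed
    then have 2: "(\<lambda>n. T s (X n, v)) \<longlonglongrightarrow> T s (- 1, v)" by simp
    have "norm (X n) < 1" for n using X[of n] by auto
    then have "T s (X n, v) = lerch_cont s v (X n)" for n
      using T_series[OF X] lerch_cont_ball(2)[OF v0] by simp
    with 1 2 show ?thesis using LIMSEQ_unique by auto
  qed
  moreover have "(- 1, v) \<in> ?V" using v by (auto intro!: image_eqI[of _ _ "-1"])
  ultimately show ?thesis using T_hol Tf by (simp add: f_def)
qed

lemma lerch_cont_shift:
  assumes "v \<notin> \<int>\<^sub>\<le>\<^sub>0" "z \<notin> lerch_cut"
  shows "lerch_cont s v z = 1 / v powr s + z * lerch_cont s (v + 1) z"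
  by (rule lerch_cont_eqI[OF is_lerch_shift[OF is_lerch_cont]])
     (use assms plus_1_notin_nonpos_Ints in auto)

lemma lerch_cont_minus_1:
  assumes "v \<notin> \<int>\<^sub>\<le>\<^sub>0"
  shows "(\<lambda>s. lerch_cont s v (- 1)) holomorphic_on UNIV \<and>
         (\<forall>s. Re s > 1 \<longrightarrow> lerch_cont s v (- 1) = lerch_series (- 1) s v)"
  using assms
proof (induction v rule: shift_to_halfplane_induct[where c = 1])
  case (halfplane v)
  then show ?case by (intro lerch_cont_minus_1_halfplane)
next
  case (shift v)
  have "v \<noteq> 0" using shift(1) by auto
  moreover have "lerch_cont s v (- 1) = 1 / v powr s + (- 1) * lerch_cont s (v + 1) (- 1)" for s
    by (rule lerch_cont_shift) (use shift(1) in \<open>auto simp: lerch_cut_eq\<close>)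
  ultimately show ?case
    using shift lerch_series_shift[OF shift(1), of "- 1"] by (auto intro!: holomorphic_intros)
qed

section \<open>The Hurwitz zeta function\<close>

text \<open>
  Descent is applied to \<open>(s - 1) \<zeta>(s, v)\<close>, which extends to an entire function of \<open>s\<close>; division by
  \<open>s - 1\<close> leaves the single pole.
\<close>

lemma hurwitz_continuation_exists:
  assumes "v \<notin> \<int>\<^sub>\<le>\<^sub>0"
  shows "\<exists>H. H holomorphic_on - {1} \<and> (\<forall>s. Re s > 1 \<longrightarrow> H s = lerch_series 1 s v)"
  using assms
proof (induction v rule: shift_to_halfplane_induct[where c = 1])
  case (halfplane v)
  let ?V = "{1} \<times> {v::complex. Re v > 1}"
  define f where "f = (\<lambda>s (z, v). (s - 1) * lerch_series z s v)"
  define I where "I g s u = integral {0..1} (\<lambda>y. (1 - of_real y) * g (s + 1) (fst u, snd u + of_real y))"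
    for g :: "complex \<Rightarrow> complex \<times> complex \<Rightarrow> complex" and s u
  define R where "R g s u = snd u powr (1 - s) + (1 * s + - 1) * 1 * I g s u" for g s u
  have "\<exists>T. (\<forall>c'. holomorphic_family c' ?V T) \<and> (\<forall>s u. Re s > 2 \<longrightarrow> u \<in> ?V \<longrightarrow> T s u = f s u)"
  proof (rule holomorphic_family_extend[where R = R])
    have "holomorphic_family 1 ?V (\<lambda>s (z, v). lerch_series z s v)"
      using holomorphic_family_lerch_series unfolding holomorphic_family_def
      by (auto elim!: continuous_on_subset)
    then have "holomorphic_family 1 ?V (\<lambda>s u. (1 * s + - 1) * 1 * (case u of (z, v) \<Rightarrow> lerch_series z s v))"
      by (intro holomorphic_family_algebra(2) holomorphic_family_factor) auto
    then show "holomorphic_family 2 ?V f"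
      by (rule holomorphic_family_cong) (auto simp: f_def)
    show "holomorphic_family (c - 1) ?V (R g)" if g: "holomorphic_family c ?V g" for c g
    proof -
      have "holomorphic_family (c - 1) ?V (I g)"
        unfolding I_def by (rule holomorphic_family_integral_shift[OF g]) (auto intro!: continuous_intros)
      then show ?thesis unfolding R_def
        by (intro holomorphic_family_algebra holomorphic_family_factor holomorphic_family_powr) auto
    qed
    show "R g s u = R h s u" if "\<And>u. u \<in> ?V \<Longrightarrow> g (s + 1) u = h (s + 1) u" "u \<in> ?V" for g h s u
    proof -
      have "I g s u = I h s u" unfolding I_def
        by (rule Henstock_Kurzweil_Integration.integral_cong) (use that in auto)
      then show ?thesis by (simp add: R_def)
    qed
    show "R f s u = f s u" if "Re s > 2" "u \<in> ?V" for s u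
      using zeta_series_descent[of s "snd u"] that
      by (auto simp: R_def f_def I_def case_prod_beta)
  qed
  then obtain T where good: "\<And>c'. holomorphic_family c' ?V T"
    and Tf: "\<And>s u. Re s > 2 \<Longrightarrow> u \<in> ?V \<Longrightarrow> T s u = f s u" by blast
  have u: "(1, v) \<in> ?V" using halfplane by simp
  have T_hol: "(\<lambda>s. T s (1, v)) holomorphic_on A" for A
    using good u by (rule holomorphic_family_entire)
  have "T s (1, v) = (s - 1) * lerch_series 1 s v" if "Re s > 1" for s
  proof (rule analytic_continuation_open[where f = "\<lambda>s. T s (1, v)" and g = "\<lambda>s. (s - 1) * lerch_series 1 s v"
        and s = "{s. Re s > 2}" and s' = "{s. Re s > 1}"])
    show "{s::complex. Re s > 2} \<noteq> {}" by (auto intro!: exI[of _ 3])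
    show "connected {s::complex. Re s > 1}" by (intro convex_connected convex_halfspace_Re_gt)
    have "(\<lambda>s. lerch_series 1 s v) holomorphic_on {s. Re s > 1}"
      using holomorphic_family_lerch_series halfplane by (auto simp: holomorphic_family_def)
    then show "(\<lambda>s. (s - 1) * lerch_series 1 s v) holomorphic_on {s. Re s > 1}"
      by (intro holomorphic_intros)
    show "T s (1, v) = (s - 1) * lerch_series 1 s v" if "s \<in> {s. Re s > 2}" for s
      using Tf[of s "(1, v)"] u that by (simp add: f_def)
  qed (use T_hol that in \<open>auto simp: open_halfspace_Re_gt\<close>)
  then show ?case
    by (intro exI[of _ "\<lambda>s. T s (1, v) / (s - 1)"]) (auto intro!: holomorphic_intros T_hol)
next
  case (shift v)
  then obtain H where "H holomorphic_on - {1}" "\<And>s. Re s > 1 \<Longrightarrow> H s = lerch_series 1 s (v + 1)" by blast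
  moreover have "v \<noteq> 0" using shift(1) by auto
  ultimately show ?case using lerch_series_shift[OF shift(1), of 1]
    by (intro exI[of _ "\<lambda>s. 1 / v powr s + H s"]) (auto intro!: holomorphic_intros)
qed

lemma hurwitz_zeta_continues:
  assumes "v \<notin> \<int>\<^sub>\<le>\<^sub>0"
  shows "(\<lambda>s. hurwitz_zeta s v) holomorphic_on - {1}"
    and "Re s > 1 \<Longrightarrow> hurwitz_zeta s v = lerch_series 1 s v"
proof -
  obtain H where H: "H holomorphic_on - {1}" "\<forall>s. Re s > 1 \<longrightarrow> H s = lerch_series 1 s v"
    using hurwitz_continuation_exists[OF assms] by blast
  have "continuation (\<lambda>t. lerch_series 1 t v) {t. Re t > 1} (- {1}) holomorphic_on - {1} \<and>
    (\<forall>w\<in>{t. Re t > 1}. continuation (\<lambda>t. lerch_series 1 t v) {t. Re t > 1} (- {1}) w = lerch_series 1 w v)"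
    unfolding continuation_def by (rule someI[of _ H]) (use H in auto)
  then show "(\<lambda>s. hurwitz_zeta s v) holomorphic_on - {1}"
    and "Re s > 1 \<Longrightarrow> hurwitz_zeta s v = lerch_series 1 s v"
    unfolding hurwitz_zeta_def by auto
qed

section \<open>The duplication formula\<close>

lemma half_shift_notin_nonpos_Ints:
  assumes "v \<notin> \<int>\<^sub>\<le>\<^sub>0"
  shows "(1 + v) / 2 \<notin> (\<int>\<^sub>\<le>\<^sub>0 :: complex set)"
proof
  assume "(1 + v) / 2 \<in> \<int>\<^sub>\<le>\<^sub>0"
  then obtain n where n: "(1 + v) / 2 = of_int n" "n \<le> 0" by (auto elim!: nonpos_Ints_cases)
  then have "v = of_int (2 * n - 1)" by (simp add: field_simps eq_diff_eq add.commute)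
  moreover have "complex_of_int (2 * n - 1) \<in> \<int>\<^sub>\<le>\<^sub>0"
    unfolding nonpos_Ints_def using n(2) by (intro CollectI exI[of _ "2 * n - 1"]) simp
  ultimately show False using assms by simp
qed

text \<open>
  The even terms of the two series cancel, and the odd index \<open>2 l + 1\<close> gives
  \<open>(2 l + 1 + v) powr s = 2 powr s * (l + (1 + v) / 2) powr s\<close>, as the factor \<open>2\<close> is positive.
\<close>

lemma lerch_series_duplication:
  assumes v: "v \<notin> \<int>\<^sub>\<le>\<^sub>0" and w: "norm w < 1 \<or> norm w = 1 \<and> Re s > 1"
  shows "lerch_series w s v - lerch_series (- w) s v
           = 2 powr (1 - s) * w * lerch_series (w\<^sup>2) s ((1 + v) / 2)"
proof -
  have conv: "(\<lambda>j. z ^ j / (of_nat j + u) powr s) sums lerch_series z s u"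
    if "u \<notin> \<int>\<^sub>\<le>\<^sub>0" "norm z < 1 \<or> norm z = 1 \<and> Re s > 1" for z u
    using that lerch_cont_ball(1)[of u z s] lerch_series_sums[of u z s] by auto
  define f where "f j = w ^ j / (of_nat j + v) powr s - (- w) ^ j / (of_nat j + v) powr s" for j
  have "norm (w\<^sup>2) < 1 \<or> norm (w\<^sup>2) = 1 \<and> Re s > 1"
    using w by (auto simp: norm_power power_less_one_iff)
  then have "(\<lambda>l. 2 powr (1 - s) * w * ((w\<^sup>2) ^ l / (of_nat l + (1 + v) / 2) powr s)) sums
      (2 powr (1 - s) * w * lerch_series (w\<^sup>2) s ((1 + v) / 2))"
    by (intro sums_mult conv half_shift_notin_nonpos_Ints v)
  moreover have "2 powr (1 - s) * w * ((w\<^sup>2) ^ l / (of_nat l + (1 + v) / 2) powr s) = f (2 * l + 1)" for l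
  proof -
    have "of_nat (2 * l + 1) + v = 2 * (of_nat l + (1 + v) / 2)" by (simp add: field_simps)
    then have "(of_nat (2 * l + 1) + v) powr s = 2 powr s * (of_nat l + (1 + v) / 2) powr s"
      by (simp only: powr_times_real_left Reals_numeral complex_Re_numeral zero_le_numeral)
    moreover have "(- w) ^ (2 * l + 1) = - (w ^ (2 * l + 1))" by (simp add: power_minus_odd)
    ultimately show ?thesis
      by (simp add: f_def powr_diff power_mult[symmetric] field_simps)
  qed
  ultimately have "(\<lambda>l. f (2 * l + 1)) sums (2 powr (1 - s) * w * lerch_series (w\<^sup>2) s ((1 + v) / 2))"
    by simp
  moreover have "(\<lambda>l. f (2 * l + 1)) sums c \<longleftrightarrow> f sums c" for c
  proof (rule sums_mono_reindex)
    show "strict_mono (\<lambda>l::nat. 2 * l + 1)" by (auto simp: strict_mono_def)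
    show "f j = 0" if "j \<notin> range (\<lambda>l. 2 * l + 1)" for j
    proof -
      have "even j"
      proof (rule ccontr)
        assume "odd j"
        then obtain l where "j = 2 * l + 1" by (rule oddE)
        then show False using that by blast
      qed
      then show ?thesis by (simp add: f_def)
    qed
  qed
  moreover have "f sums (lerch_series w s v - lerch_series (- w) s v)"
    unfolding f_def by (intro sums_diff conv v) (use w in auto)
  ultimately show ?thesis by (metis sums_unique2)
qed

lemma square_notin_lerch_cut:
  assumes "w \<notin> lerch_cut" "- w \<notin> lerch_cut"
  shows "w\<^sup>2 \<notin> lerch_cut"
proof
  assume "w\<^sup>2 \<in> lerch_cut"
  then have "Re w * Im w = 0" "(Re w)\<^sup>2 - (Im w)\<^sup>2 \<ge> 1" by (auto simp: lerch_cut_eq power2_eq_square)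
  moreover have "Im w = 0"
  proof (rule ccontr)
    assume "Im w \<noteq> 0"
    then have "Re w = 0" using \<open>Re w * Im w = 0\<close> by simp
    then show False using \<open>(Re w)\<^sup>2 - (Im w)\<^sup>2 \<ge> 1\<close> zero_le_power2[of "Im w"] by simp
  qed
  ultimately have "Im w = 0" "(Re w)\<^sup>2 \<ge> 1" by auto
  then have "Im w = 0" "\<bar>Re w\<bar> \<ge> 1" using abs_le_square_iff[of 1 "Re w"] by auto
  then show False using assms by (auto simp: lerch_cut_eq)
qed

text \<open>
  Where \<open>w\<close> and \<open>- w\<close> avoid the cut, so does \<open>w\<^sup>2\<close>; this domain is star-shaped about the origin, and the
  identity theorem extends the formula to it from the disc.
\<close>

lemma lerch_cont_duplication:
  assumes v: "v \<notin> \<int>\<^sub>\<le>\<^sub>0" and w: "w \<notin> lerch_cut" "- w \<notin> lerch_cut"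
  shows "lerch_cont s v w - lerch_cont s v (- w)
           = 2 powr (1 - s) * w * lerch_cont s ((1 + v) / 2) (w\<^sup>2)"
proof -
  let ?D = "{w. w \<notin> lerch_cut \<and> - w \<notin> lerch_cut}"
  have hol: "lerch_cont s u holomorphic_on - lerch_cut" if "u \<notin> \<int>\<^sub>\<le>\<^sub>0" for u
    using is_lerch_cont[OF that] by (simp add: is_lerch_def)
  note v2 = half_shift_notin_nonpos_Ints[OF v]
  have comp: "(\<lambda>w. lerch_cont s u (g w)) holomorphic_on ?D"
    if "u \<notin> \<int>\<^sub>\<le>\<^sub>0" "g holomorphic_on ?D" "\<And>w. w \<in> ?D \<Longrightarrow> g w \<notin> lerch_cut" for u g
    using holomorphic_on_compose_gen[OF that(2) hol[OF that(1)]] that(3) by (force simp: o_def)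
  show ?thesis
  proof (rule analytic_continuation_open[where s = "ball 0 1" and s' = ?D
        and f = "\<lambda>w. lerch_cont s v w - lerch_cont s v (- w)"
        and g = "\<lambda>w. 2 powr (1 - s) * w * lerch_cont s ((1 + v) / 2) (w\<^sup>2)"])
    have "?D = - lerch_cut \<inter> uminus -` (- lerch_cut)" by auto
    then show "open ?D"
      by (simp only:) (intro open_Int open_compl_lerch_cut open_vimage continuous_intros)
    show "connected ?D"
    proof (rule starlike_imp_connected)
      show "starlike ?D"
        unfolding starlike_def
      proof (intro bexI[of _ 0] ballI subsetI)
        fix z y assume "z \<in> ?D" "y \<in> closed_segment 0 z"
        then show "y \<in> ?D" using scale_notin_lerch_cut[of z] scale_notin_lerch_cut[of "- z"]
          by (auto simp: in_segment scaleR_conv_of_real)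
      qed (auto simp: lerch_cut_eq)
    qed
    show "ball 0 1 \<subseteq> ?D"
      using ball_subset_compl_lerch_cut by (auto simp: subset_iff)
    show "(\<lambda>w. lerch_cont s v w - lerch_cont s v (- w)) holomorphic_on ?D"
      by (intro holomorphic_on_diff comp v holomorphic_intros) auto
    show "(\<lambda>w. 2 powr (1 - s) * w * lerch_cont s ((1 + v) / 2) (w\<^sup>2)) holomorphic_on ?D"
      by (intro holomorphic_on_mult comp v2 holomorphic_intros square_notin_lerch_cut) auto
    fix z :: complex assume "z \<in> ball 0 1"
    then have z: "norm z < 1" by simp
    then have "norm (z\<^sup>2) < 1" by (simp add: norm_power power_less_one_iff)
    then show "lerch_cont s v z - lerch_cont s v (- z) = 2 powr (1 - s) * z * lerch_cont s ((1 + v) / 2) (z\<^sup>2)"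
      using lerch_series_duplication[OF v, of z s] z lerch_cont_ball(2)[OF v] lerch_cont_ball(2)[OF v2]
      by simp
  qed (use w in auto)
qed

text \<open>
  The case \<open>w = 1\<close>, where the identity theorem is applied in \<open>s\<close> instead of \<open>w\<close>.
\<close>

lemma hurwitz_zeta_duplication:
  assumes v: "v \<notin> \<int>\<^sub>\<le>\<^sub>0" and s: "s \<noteq> 1"
  shows "hurwitz_zeta s v - lerch_cont s v (- 1) = 2 powr (1 - s) * hurwitz_zeta s ((1 + v) / 2)"
proof (rule analytic_continuation_open[where s = "{s. Re s > 1}" and s' = "- {1}"
      and f = "\<lambda>s. hurwitz_zeta s v - lerch_cont s v (- 1)"
      and g = "\<lambda>s. 2 powr (1 - s) * hurwitz_zeta s ((1 + v) / 2)"])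
  note v2 = half_shift_notin_nonpos_Ints[OF v]
  have 1: "(\<lambda>s. lerch_cont s v (- 1)) holomorphic_on - {1}"
    using lerch_cont_minus_1[OF v] by (auto elim: holomorphic_on_subset)
  show "(\<lambda>s. hurwitz_zeta s v - lerch_cont s v (- 1)) holomorphic_on - {1}"
    by (intro holomorphic_intros 1 hurwitz_zeta_continues(1) v)
  show "(\<lambda>s. 2 powr (1 - s) * hurwitz_zeta s ((1 + v) / 2)) holomorphic_on - {1}"
    by (intro holomorphic_intros hurwitz_zeta_continues(1) v2) auto
  show "{s::complex. Re s > 1} \<noteq> {}" by (auto intro!: exI[of _ 2])
  show "connected (- {1::complex})" by (rule connected_punctured_universe) simp
  show "hurwitz_zeta z v - lerch_cont z v (- 1) = 2 powr (1 - z) * hurwitz_zeta z ((1 + v) / 2)"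
    if "z \<in> {s. Re s > 1}" for z
    using that lerch_series_duplication[OF v, of 1 z] hurwitz_zeta_continues(2)[OF v]
      hurwitz_zeta_continues(2)[OF v2] lerch_cont_minus_1[OF v] by simp
qed (use s in \<open>auto simp: open_halfspace_Re_gt\<close>)

text \<open>
  The three branches in the definition of \<open>lerch_phi\<close> never mix, except at \<open>w = 1\<close> and \<open>w = - 1\<close>: the
  norms of \<open>w\<close>, \<open>- w\<close> and \<open>w\<^sup>2\<close> lie on the same side of one, and \<open>w\<^sup>2 = 1\<close> only at these two points.
\<close>

lemma lerch_phi_duplication:
  assumes "lerch_phi_defined w s v" "lerch_phi_defined (- w) s v"
  shows "lerch_phi w s v - lerch_phi (- w) s v
           = 2 powr (1 - s) * w * lerch_phi (w\<^sup>2) s ((1 + v) / 2)"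
proof (cases "norm w < 1 \<or> norm w = 1 \<and> Re s > 1")
  case True
  then have "norm (w\<^sup>2) < 1 \<or> norm (w\<^sup>2) = 1 \<and> Re s > 1"
    by (auto simp: norm_power power_less_one_iff)
  then show ?thesis
    using True lerch_series_duplication[OF _ True, of v] assms
    by (simp add: lerch_phi_def lerch_phi_defined_def)
next
  case False
  have v: "v \<notin> \<int>\<^sub>\<le>\<^sub>0" using assms(1) by (simp add: lerch_phi_defined_def)
  have off: "\<not> (norm (w\<^sup>2) < 1 \<or> norm (w\<^sup>2) = 1 \<and> Re s > 1)"
    using False by (auto simp: norm_power power_less_one_iff power2_eq_1_iff)
  have one: "(1::complex) \<in> lerch_cut" by (simp add: lerch_cut_eq)
  consider "w = 1" | "w = - 1" | "w \<noteq> 1" "w \<noteq> - 1" by blast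
  then show ?thesis
  proof cases
    case 1
    then have "s \<noteq> 1" using assms one by (auto simp: lerch_phi_defined_def)
    then show ?thesis
      using hurwitz_zeta_duplication[OF v] 1 False by (simp add: lerch_phi_def lerch_cont_def)
  next
    case 2
    then have "s \<noteq> 1" using assms one by (auto simp: lerch_phi_defined_def)
    then show ?thesis
      using hurwitz_zeta_duplication[OF v, of s] 2 False
      by (simp add: lerch_phi_def lerch_cont_def algebra_simps)
  next
    case 3
    then have "w \<notin> lerch_cut" "- w \<notin> lerch_cut"
      using assms by (auto simp: lerch_phi_defined_def minus_equation_iff)
    moreover have "w\<^sup>2 \<noteq> 1" using 3 by (simp add: power2_eq_1_iff)
    moreover have "- w \<noteq> 1" using 3 by (metis minus_minus)
    ultimately show ?thesis
      using lerch_cont_duplication[OF v, of w s] 3 False off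
      by (simp add: lerch_phi_def lerch_cont_def del: de_Morgan_disj de_Morgan_conj)
  qed
qed

section \<open>The telescoping sum\<close>

theorem theorem4p133:
  fixes n :: nat and k m a :: complex
  assumes "n \<ge> 1" and "a \<noteq> 0"
    and "\<And>p. p \<in> {1..n} \<Longrightarrow>
           lerch_phi_defined (- exp (\<i> * m * pi / 2 ^ p)) (- k) (1 - \<i> * 2 ^ p * Ln a / pi)"
    and "\<And>p. p \<in> {1..n} \<Longrightarrow>
           lerch_phi_defined (- \<i> * exp (\<i> * m * pi / 2 ^ p)) (- k) (1 - \<i> * 2 ^ p * Ln a / pi)"
    and "\<And>p. p \<in> {1..n} \<Longrightarrow>
           lerch_phi_defined (\<i> * exp (\<i> * m * pi / 2 ^ p)) (- k) (1 - \<i> * 2 ^ p * Ln a / pi)"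
    and "lerch_phi_defined (- exp (\<i> * m * pi)) (- k) (1 - \<i> * Ln a / pi)"
  shows
    "(\<Sum>p = 1..n.
        1 / 2 * (\<i> / 2 ^ p) powr k * exp (\<i> * m * pi / 2 ^ p) * complex_of_real pi powr (1 + k) *
        (2 * \<i> * lerch_phi (- exp (\<i> * m * pi / 2 ^ p)) (- k) (1 - \<i> * 2 ^ p * Ln a / pi)
         + lerch_phi (- \<i> * exp (\<i> * m * pi / 2 ^ p)) (- k) (1 - \<i> * 2 ^ p * Ln a / pi)
         - lerch_phi (\<i> * exp (\<i> * m * pi / 2 ^ p)) (- k) (1 - \<i> * 2 ^ p * Ln a / pi)))
     = - \<i> * pi *
        (exp (\<i> * m * pi) * (\<i> * pi) powr k *
           lerch_phi (- exp (\<i> * m * pi)) (- k) (1 - \<i> * Ln a / pi)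
         - (\<i> / 2 ^ n) powr k * exp (\<i> * m * pi / 2 ^ n) * complex_of_real pi powr k *
           lerch_phi (- exp (\<i> * m * pi / 2 ^ n)) (- k) (1 - \<i> * 2 ^ n * Ln a / pi))"
proof -
  define E where "E p = exp (\<i> * m * pi / 2 ^ p)" for p :: nat
  define v where "v p = 1 - \<i> * 2 ^ p * Ln a / pi" for p :: nat
  define T where "T p = (\<i> / 2 ^ p) powr k * E p * lerch_phi (- E p) (- k) (v p)" for p
  define c where "c = \<i> * complex_of_real pi powr (1 + k)"
  have step: "1 / 2 * (\<i> / 2 ^ p) powr k * E p * complex_of_real pi powr (1 + k) *
        (2 * \<i> * lerch_phi (- E p) (- k) (v p) + lerch_phi (- \<i> * E p) (- k) (v p)
           - lerch_phi (\<i> * E p) (- k) (v p)) = c * (T p - T (p - 1))"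
    if p: "p \<in> {1..n}" for p
  proof -
    obtain q where q: "p = Suc q" using p by (cases p) auto
    have E2: "(\<i> * E p)\<^sup>2 = - E q"
      by (simp add: E_def q power_mult_distrib flip: exp_double)
    have v2: "(1 + v p) / 2 = v q" by (simp add: v_def q field_simps)
    have i2: "(\<i> / 2 ^ q) powr k = 2 powr k * (\<i> / 2 ^ p) powr k"
    proof -
      have "\<i> / 2 ^ q = 2 * (\<i> / 2 ^ p)" by (simp add: q)
      then show ?thesis by (simp only: powr_times_real_left Reals_numeral complex_Re_numeral zero_le_numeral)
    qed
    have "lerch_phi (\<i> * E p) (- k) (v p) - lerch_phi (- (\<i> * E p)) (- k) (v p)
        = 2 powr (1 - - k) * (\<i> * E p) * lerch_phi ((\<i> * E p)\<^sup>2) (- k) ((1 + v p) / 2)"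
      by (rule lerch_phi_duplication) (use assms(4,5)[OF p] in \<open>simp_all add: E_def v_def\<close>)
    then have dup: "lerch_phi (- \<i> * E p) (- k) (v p) - lerch_phi (\<i> * E p) (- k) (v p)
        = - (2 * 2 powr k * (\<i> * E p) * lerch_phi (- E q) (- k) (v q))"
      unfolding E2 v2 by (simp add: powr_add algebra_simps)
    have EE: "E p * E p = E q" using E2 by (simp add: power2_eq_square algebra_simps)
    have "2 * \<i> * lerch_phi (- E p) (- k) (v p) + lerch_phi (- \<i> * E p) (- k) (v p)
            - lerch_phi (\<i> * E p) (- k) (v p)
        = 2 * \<i> * (lerch_phi (- E p) (- k) (v p) - 2 powr k * E p * lerch_phi (- E q) (- k) (v q))"
      using dup by (simp add: algebra_simps)
    moreover have "T (p - 1) = 2 powr k * (\<i> / 2 ^ p) powr k * (E p * E p) * lerch_phi (- E q) (- k) (v q)"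
      by (simp add: T_def q[symmetric] i2 EE) (simp add: q T_def i2)
    moreover have "T p = (\<i> / 2 ^ p) powr k * E p * lerch_phi (- E p) (- k) (v p)" by (rule T_def)
    ultimately show ?thesis by (simp only: c_def) (simp add: algebra_simps)
  qed
  have "(\<Sum>p = 1..N. T p - T (p - 1)) = T N - T 0" for N
    by (induction N) auto
  then have "(\<Sum>p = 1..n. c * (T p - T (p - 1))) = c * (T n - T 0)"
    by (simp flip: sum_distrib_left)
  also have "\<dots> = - \<i> * pi * (E 0 * (\<i> * pi) powr k * lerch_phi (- E 0) (- k) (v 0)
         - (\<i> / 2 ^ n) powr k * E n * complex_of_real pi powr k * lerch_phi (- E n) (- k) (v n))"
  proof -
    have "(\<i> * pi) powr k = complex_of_real pi powr k * \<i> powr k"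
      using powr_times_real_left[of "complex_of_real pi" \<i> k] by (simp add: mult.commute)
    moreover have "complex_of_real pi powr (1 + k) = pi * complex_of_real pi powr k"
      by (simp add: powr_add)
    ultimately show ?thesis by (simp add: c_def T_def algebra_simps)
  qed
  finally have "(\<Sum>p = 1..n. c * (T p - T (p - 1))) =
      - \<i> * pi * (E 0 * (\<i> * pi) powr k * lerch_phi (- E 0) (- k) (v 0)
         - (\<i> / 2 ^ n) powr k * E n * complex_of_real pi powr k * lerch_phi (- E n) (- k) (v n))" .
  moreover have "(\<Sum>p = 1..n. 1 / 2 * (\<i> / 2 ^ p) powr k * E p * complex_of_real pi powr (1 + k) *
        (2 * \<i> * lerch_phi (- E p) (- k) (v p) + lerch_phi (- \<i> * E p) (- k) (v p)
           - lerch_phi (\<i> * E p) (- k) (v p))) = (\<Sum>p = 1..n. c * (T p - T (p - 1)))"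
    by (rule sum.cong) (use step in auto)
  ultimately show ?thesis by (simp add: E_def v_def)
qed

end
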